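(* Let $p>1$ be a real number and let $G$ be a countably infinite, connected graph of bounded degree without self-loops, with vertex set $V$. If $f$ is a continuous real-valued function on $\partial_p(G)$, then there exists a $p$-harmonic function $h$ on $V$ such that for every $x\in\partial_p(G)$ and every sequence $(x_n)$ in $V$ that converges to $x$ (in $Sp(BD_p(G))$), one has $\lim_{n\to\infty}h(x_n)=f(x)$.
   Context: Let $N_x$ be the set of neighbors of $x\in V$, and $o\in V$ a fixed vertex. Bounded degree means there is an integer $k$ with $\#N_x\le k$ for all $x$. For $f\colon V\to\mathbb{R}$ put $I_p(f,V)=\sum_{x\in V}\sum_{y\in N_x}|f(y)-f(x)|^p$ and $\Delta_p f(x)=\sum_{y\in N_x}|f(y)-f(x)|^{p-2}(f(y)-f(x))$, where a term is $0$ if $f(y)=f(x)$. $f$ is $p$-harmonic on $V$ if $\Delta_pf(x)=0$ for all $x\in V$. $D_p(G)=\{f\colon V\to\mathbb{R}\mid I_p(f,V)<\infty\}$ with norm $\|f\|_{D_p}=(I_p(f,V)+|f(o)|^p)^{1/p}$. $\ell^\infty(G)$ is the set of bounded real functions on $V$, and $BD_p(G)=D_p(G)\cap\ell^\infty(G)$, a commutative Banach algebra under pointwise multiplication with norm $\|f\|_{BD_p}=I_p(f,V)^{1/p}+\sup_V|f|$. $\mathbb{R}G$ is the set of finitely supported real functions on $V$, $(\overline{\mathbb{R}G})_{D_p}$ is its closure in $D_p(G)$, and $B(\overline{\mathbb{R}G})_{D_p}=(\overline{\mathbb{R}G})_{D_p}\cap\ell^\infty(G)$. $Sp(BD_p(G))$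 is the set of nonzero algebra homomorphisms $BD_p(G)\to\mathbb{C}$ with the weak-$*$ topology (pointwise convergence on $BD_p(G)$), a compact Hausdorff space. For $f\in BD_p(G)$, $\hat f(\tau)=\tau(f)$. $V$ is identified with its image in $Sp(BD_p(G))$ under $x\mapsto(f\mapsto f(x))$. The $p$-Royden boundary is $R_p(G)=Sp(BD_p(G))\setminus V$, and the $p$-harmonic boundary, with the subspace topology, is $\partial_p(G)=\{x\in R_p(G)\mid \hat f(x)=0\text{ for all }f\in B(\overline{\mathbb{R}G})_{D_p}\}$. *)

theory Defs
  imports "HOL-Analysis.Analysis"
begin

text \<open>
  A graph is given by its adjacency relation \<open>E\<close> on the type \<open>'v\<close>; its vertex set \<open>V\<close> is the
  whole type, so real functions on \<open>V\<close> are exactly the elements of \<open>'v \<Rightarrow> real\<close>.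
\<close>

definition neighbors :: "('v \<Rightarrow> 'v \<Rightarrow> bool) \<Rightarrow> 'v \<Rightarrow> 'v set" where
  "neighbors E x = {y. E x y}"

definition connected_graph :: "('v \<Rightarrow> 'v \<Rightarrow> bool) \<Rightarrow> bool" where
  "connected_graph E \<longleftrightarrow> (\<forall>x y. E\<^sup>*\<^sup>* x y)"

definition bounded_degree :: "('v \<Rightarrow> 'v \<Rightarrow> bool) \<Rightarrow> bool" where
  "bounded_degree E \<longleftrightarrow> (\<exists>k::nat. \<forall>x. finite (neighbors E x) \<and> card (neighbors E x) \<le> k)"

definition local_energy :: "('v \<Rightarrow> 'v \<Rightarrow> bool) \<Rightarrow> real \<Rightarrow> ('v \<Rightarrow> real) \<Rightarrow> 'v \<Rightarrow> real" where
  "local_energy E p f x = (\<Sum>y\<in>neighbors E x. \<bar>f y - f x\<bar> powr p)"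

text \<open>
  The summands are nonnegative, so finiteness of the energy is summability.  The real number
  \<open>energy E p f\<close> is meaningful only for \<open>f \<in> Dp E p\<close> (it is \<open>0\<close> for divergent sums).
\<close>

definition energy :: "('v \<Rightarrow> 'v \<Rightarrow> bool) \<Rightarrow> real \<Rightarrow> ('v \<Rightarrow> real) \<Rightarrow> real" where
  "energy E p f = (\<Sum>\<^sub>\<infinity>x. local_energy E p f x)"

definition Dp :: "('v \<Rightarrow> 'v \<Rightarrow> bool) \<Rightarrow> real \<Rightarrow> ('v \<Rightarrow> real) set" where
  "Dp E p = {f. local_energy E p f summable_on UNIV}"

definition Dp_norm :: "('v \<Rightarrow> 'v \<Rightarrow> bool) \<Rightarrow> real \<Rightarrow> 'v \<Rightarrow> ('v \<Rightarrow> real) \<Rightarrow> real" where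
  "Dp_norm E p v0 f = (energy E p f + \<bar>f v0\<bar> powr p) powr (1 / p)"

text \<open>Terms with \<open>f y = f x\<close> vanish because of the second factor, also when \<open>p < 2\<close>.\<close>

definition p_laplacian :: "('v \<Rightarrow> 'v \<Rightarrow> bool) \<Rightarrow> real \<Rightarrow> ('v \<Rightarrow> real) \<Rightarrow> 'v \<Rightarrow> real" where
  "p_laplacian E p f x = (\<Sum>y\<in>neighbors E x. \<bar>f y - f x\<bar> powr (p - 2) * (f y - f x))"

definition p_harmonic :: "('v \<Rightarrow> 'v \<Rightarrow> bool) \<Rightarrow> real \<Rightarrow> ('v \<Rightarrow> real) \<Rightarrow> bool" where
  "p_harmonic E p f \<longleftrightarrow> (\<forall>x. p_laplacian E p f x = 0)"

definition BDp :: "('v \<Rightarrow> 'v \<Rightarrow> bool) \<Rightarrow> real \<Rightarrow> ('v \<Rightarrow> real) set" where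
  "BDp E p = {f \<in> Dp E p. bounded (range f)}"

definition finsupp_funs :: "('v \<Rightarrow> real) set" where
  "finsupp_funs = {g. finite {x. g x \<noteq> 0}}"

definition finsupp_closure :: "('v \<Rightarrow> 'v \<Rightarrow> bool) \<Rightarrow> real \<Rightarrow> 'v \<Rightarrow> ('v \<Rightarrow> real) set" where
  "finsupp_closure E p v0 =
     {f \<in> Dp E p. \<forall>\<epsilon>>0. \<exists>g\<in>finsupp_funs. Dp_norm E p v0 (\<lambda>x. f x - g x) < \<epsilon>}"

definition bdd_finsupp_closure :: "('v \<Rightarrow> 'v \<Rightarrow> bool) \<Rightarrow> real \<Rightarrow> 'v \<Rightarrow> ('v \<Rightarrow> real) set" where
  "bdd_finsupp_closure E p v0 = {f \<in> finsupp_closure E p v0. bounded (range f)}"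

text \<open>
  Characters of the real algebra \<open>BDp E p\<close>.  They are represented by functions on all of
  \<open>'v \<Rightarrow> real\<close> that are \<open>undefined\<close> outside \<open>BDp E p\<close>, so that equality of representatives is
  equality of characters.
\<close>

definition Sp :: "('v \<Rightarrow> 'v \<Rightarrow> bool) \<Rightarrow> real \<Rightarrow> (('v \<Rightarrow> real) \<Rightarrow> complex) set" where
  "Sp E p = {\<tau> \<in> extensional (BDp E p).
     (\<forall>f\<in>BDp E p. \<forall>g\<in>BDp E p. \<tau> (\<lambda>x. f x + g x) = \<tau> f + \<tau> g) \<and>
     (\<forall>c::real. \<forall>f\<in>BDp E p. \<tau> (\<lambda>x. c * f x) = of_real c * \<tau> f) \<and>
     (\<forall>f\<in>BDp E p. \<forall>g\<in>BDp E p. \<tau> (\<lambda>x. f x * g x) = \<tau> f * \<tau> g) \<and>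
     (\<exists>f\<in>BDp E p. \<tau> f \<noteq> 0)}"

text \<open>The weak-* topology: pointwise convergence on \<open>BDp E p\<close>.\<close>

definition Sp_topology :: "('v \<Rightarrow> 'v \<Rightarrow> bool) \<Rightarrow> real \<Rightarrow> (('v \<Rightarrow> real) \<Rightarrow> complex) topology" where
  "Sp_topology E p = subtopology (product_topology (\<lambda>_. euclidean) (BDp E p)) (Sp E p)"

definition point_eval :: "('v \<Rightarrow> 'v \<Rightarrow> bool) \<Rightarrow> real \<Rightarrow> 'v \<Rightarrow> ('v \<Rightarrow> real) \<Rightarrow> complex" where
  "point_eval E p x = restrict (\<lambda>f. complex_of_real (f x)) (BDp E p)"

definition royden_boundary :: "('v \<Rightarrow> 'v \<Rightarrow> bool) \<Rightarrow> real \<Rightarrow> (('v \<Rightarrow> real) \<Rightarrow> complex) set" where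
  "royden_boundary E p = Sp E p - range (point_eval E p)"

definition harmonic_boundary ::
    "('v \<Rightarrow> 'v \<Rightarrow> bool) \<Rightarrow> real \<Rightarrow> 'v \<Rightarrow> (('v \<Rightarrow> real) \<Rightarrow> complex) set" where
  "harmonic_boundary E p v0 =
     {\<tau> \<in> royden_boundary E p. \<forall>f\<in>bdd_finsupp_closure E p v0. \<tau> f = 0}"

end

theory Submission
  imports Defs
begin

text \<open>
  The solution is a uniform limit of bounded \<open>p\<close>-harmonic functions of finite energy whose boundary
  values approximate \<open>f\<close>.  Call a finitely supported function, or a bounded limit of such functions in
  the norm of \<open>Dp E p\<close>, null; by definition every point of the harmonic boundary vanishes on all null
  functions.

  Approximation.  Characters of \<open>BDp E p\<close> are real valued and their space is compact, so the
  Stone-Weierstrass theorem yields \<open>g\<close> in \<open>BDp E p\<close> whose Gelfand transform is uniformly close to \<open>f\<close>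
  on the harmonic boundary (\<open>boundary_density\<close>).  By the Royden decomposition \<open>g\<close> is the sum of a
  bounded \<open>p\<close>-harmonic function \<open>h\<close> and a null function (\<open>harmonic_part\<close>), so \<open>h\<close> and \<open>g\<close> have the same
  boundary values.  The function \<open>h\<close> minimizes the energy in the class of \<open>g\<close> modulo null functions;
  it exists because uniform convexity of \<open>|s|^p\<close> makes minimizing sequences converge.

  Comparison.  If two such harmonic functions satisfy \<open>h1 \<le> h2 + b\<close> on a nonempty harmonic
  boundary, then \<open>h1 \<le> h2 + b\<close> on the graph (\<open>harmonic_comparison\<close>).  To see this, let \<open>c > b\<close>.
  Compactness of the character space exhibits the excess \<open>u = max (h1 - h2 - c) 0\<close> as a product of a
  finite sum of squares of null functions with an element of \<open>BDp E p\<close>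
  (\<open>excess_weak_null\<close>), hence as a pointwise limit of finitely supported functions of bounded energy.
  The flux \<open>|s|^(p-2) s\<close> of the increments of a harmonic function of finite energy is orthogonal to
  the increments of such limits (\<open>infsum_local_pairing_harmonic\<close>).  Strict monotonicity of the flux
  then forces \<open>u\<close> to be constant, and a positive constant contradicts the boundary inequality.

  Applied to the approximating harmonic functions, comparison in both directions bounds their uniform
  distance on the graph, so they converge uniformly.  The limit is \<open>p\<close>-harmonic because the Laplacian at
  a vertex depends continuously on finitely many values.  Along a sequence of vertices that converges
  to a boundary point, each approximating function converges to its boundary value there, and
  uniformity carries this over to the limit.  If the harmonic boundary is empty, the zero function
  satisfies the claim.
\<close>

section \<open>The flux and the uniform convexity of powers\<close>

text \<open>
  The function \<open>s \<mapsto> |s|^(p-2) s\<close>, which is the derivative of \<open>|s|^p / p\<close>.  The \<open>p\<close>-Laplacian at a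
  vertex is the sum of its values at the increments along the edges there.
\<close>
definition flux :: "real \<Rightarrow> real \<Rightarrow> real" where
  "flux p s = \<bar>s\<bar> powr (p - 2) * s"

lemma flux_zero [simp]: "flux p 0 = 0"
  by (simp add: flux_def)

lemma flux_minus: "flux p (- s) = - flux p s"
  by (simp add: flux_def)

text \<open>
  Separating positive and negative part leaves powers with the positive exponent \<open>p - 1\<close>.
  In this form continuity at the origin and monotonicity are visible also for \<open>p < 2\<close>, where
  \<open>|s|^(p-2)\<close> is singular.
\<close>
lemma flux_split: "flux p s = max s 0 powr (p - 1) - max (- s) 0 powr (p - 1)"
proof -
  have pos: "\<bar>t\<bar> powr (p - 2) * t = t powr (p - 1)" if "t > 0" for t :: real
    using that powr_mult_base[of t "p - 2"] by (simp add: mult.commute)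
  consider "s > 0" | "s = 0" | "s < 0" by linarith
  then show ?thesis
    using pos[of s] pos[of "- s"] by cases (auto simp: flux_def max_def)
qed

lemma abs_flux: "\<bar>flux p s\<bar> = \<bar>s\<bar> powr (p - 1)"
  by (auto simp: flux_split max_def abs_if)

lemma flux_mult_self: "flux p s * s = \<bar>s\<bar> powr p"
proof (cases "s = 0")
  case False
  have "flux p s * s = \<bar>s\<bar> powr (p - 2) * \<bar>s\<bar> powr 2"
    by (simp add: flux_def power2_eq_square[symmetric])
  also have "\<dots> = \<bar>s\<bar> powr p"
    using powr_add[of "\<bar>s\<bar>" "p - 2" 2] by simp
  finally show ?thesis .
qed simp

lemma isCont_flux: "p > 1 \<Longrightarrow> isCont (flux p) s"
proof -
  assume p: "p > 1"
  have "isCont (\<lambda>s. max s 0 powr (p - 1) - max (- s) 0 powr (p - 1)) s"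
    using p unfolding isCont_def by (auto intro!: tendsto_intros tendsto_powr')
  then show ?thesis by (simp add: flux_split[abs_def])
qed

lemma flux_strict_mono: "p > 1 \<Longrightarrow> s < t \<Longrightarrow> flux p s < flux p t"
proof -
  assume p: "p > 1" and st: "s < t"
  have a: "max s 0 powr (p - 1) \<le> max t 0 powr (p - 1)"
    using p st by (intro powr_mono2) auto
  have b: "max (- t) 0 powr (p - 1) \<le> max (- s) 0 powr (p - 1)"
    using p st by (intro powr_mono2) auto
  have "max s 0 powr (p - 1) < max t 0 powr (p - 1) \<or>
        max (- t) 0 powr (p - 1) < max (- s) 0 powr (p - 1)"
  proof (cases "t > 0")
    case True
    then have "max s 0 powr (p - 1) < max t 0 powr (p - 1)"
      using p st by (intro powr_less_mono2) auto
    then show ?thesis ..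
  next
    case False
    then have "max (- t) 0 powr (p - 1) < max (- s) 0 powr (p - 1)"
      using p st by (intro powr_less_mono2) auto
    then show ?thesis ..
  qed
  with a b show ?thesis by (auto simp: flux_split)
qed

lemma has_derivative_abs_powr:
  assumes p: "p > 1"
  shows "((\<lambda>s. \<bar>s\<bar> powr p) has_real_derivative p * flux p s) (at s)"
proof -
  consider "s > 0" | "s = 0" | "s < 0" by linarith
  then show ?thesis
  proof cases
    case 1
    have "((\<lambda>s. s powr p) has_real_derivative p * flux p s) (at s)"
      using 1 has_real_derivative_powr[of s p] by (simp add: flux_split)
    then show ?thesis
      by (rule DERIV_cong_ev[THEN iffD1, rotated 3])
        (use 1 in \<open>auto intro!: eventually_mono[OF order_tendstoD(1)[OF tendsto_ident_at 1]]
            simp: eventually_nhds_conv_at\<close>)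
  next
    case 2
    have "((\<lambda>h. \<bar>h\<bar> powr (p - 1)) \<longlongrightarrow> \<bar>0\<bar> powr (p - 1)) (at (0::real))"
      using p by (intro tendsto_powr' tendsto_intros) auto
    then have "((\<lambda>h. \<bar>h\<bar> powr p / h) \<longlongrightarrow> 0) (at (0::real))"
    proof (intro Lim_null_comparison[where g = "\<lambda>h. \<bar>h\<bar> powr (p - 1)" and f = "\<lambda>h. \<bar>h\<bar> powr p / h"])
      show "\<forall>\<^sub>F h in at (0::real). norm (\<bar>h\<bar> powr p / h) \<le> \<bar>h\<bar> powr (p - 1)"
        by (auto simp: eventually_at_filter powr_diff intro!: always_eventually)
    qed (use p in auto)
    with 2 p show ?thesis
      unfolding DERIV_def by simp
  next
    case 3
    have "((\<lambda>s. (- s) powr p) has_real_derivative p * flux p s) (at s)"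
      using 3 by (auto intro!: derivative_eq_intros simp: flux_split)
    then show ?thesis
      by (rule DERIV_cong_ev[THEN iffD1, rotated 3])
        (use 3 in \<open>auto intro!: eventually_mono[OF order_tendstoD(2)[OF tendsto_ident_at 3]]
            simp: eventually_nhds_conv_at\<close>)
  qed
qed

text \<open>
  By the mean value theorem the increment of \<open>|s|^p\<close> from \<open>a\<close> to \<open>b\<close> is \<open>p (b - a)\<close> times the flux
  at an intermediate point, and the flux is strictly increasing.
\<close>
lemma abs_powr_above_tangent_strict:
  assumes p: "p > 1" and ne: "a \<noteq> b"
  shows "\<bar>a\<bar> powr p + p * flux p a * (b - a) < \<bar>b\<bar> powr p"
proof -
  note D = has_derivative_abs_powr[OF p]
  show ?thesis
  proof (cases "a < b")
    case True
    obtain z where z: "a < z" "z < b" "\<bar>b\<bar> powr p - \<bar>a\<bar> powr p = (b - a) * (p * flux p z)"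
      using MVT2[OF True D] by blast
    then have "(b - a) * (p * flux p a) < (b - a) * (p * flux p z)"
      using True p flux_strict_mono[OF p z(1)] by simp
    with z show ?thesis by (simp add: algebra_simps)
  next
    case False
    then have ba: "b < a" using ne by simp
    obtain z where z: "b < z" "z < a" "\<bar>a\<bar> powr p - \<bar>b\<bar> powr p = (a - b) * (p * flux p z)"
      using MVT2[OF ba D] by blast
    then have "(a - b) * (p * flux p z) < (a - b) * (p * flux p a)"
      using ba p flux_strict_mono[OF p z(2)] by simp
    with z show ?thesis by (simp add: algebra_simps)
  qed
qed

lemma abs_powr_above_tangent:
  assumes "p > 1"
  shows "\<bar>a\<bar> powr p + p * flux p a * (b - a) \<le> \<bar>b\<bar> powr p"
  using abs_powr_above_tangent_strict[OF assms, of a b] by (cases "a = b") auto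

text \<open>
  The tangent at the midpoint lies strictly below the graph at both end points, and its linear
  terms cancel on averaging.
\<close>
lemma abs_powr_midpoint_strict:
  fixes a b :: real
  assumes p: "p > 1" and ne: "a \<noteq> b"
  shows "\<bar>(a + b) / 2\<bar> powr p < (\<bar>a\<bar> powr p + \<bar>b\<bar> powr p) / 2"
proof -
  define c where "c = (a + b) / 2"
  have "c \<noteq> a" "c \<noteq> b" using ne by (auto simp: c_def)
  note t = abs_powr_above_tangent_strict[OF p this(1)] abs_powr_above_tangent_strict[OF p this(2)]
  have "p * flux p c * (a - c) + p * flux p c * (b - c) = 0"
    by (simp add: c_def field_simps)
  with t show ?thesis by (simp add: c_def[symmetric])
qed

lemma abs_add_powr_le:
  fixes a b :: real
  assumes "p > 1"
  shows "\<bar>a + b\<bar> powr p \<le> 2 powr p * (\<bar>a\<bar> powr p + \<bar>b\<bar> powr p)"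
proof -
  have "\<bar>a + b\<bar> powr p \<le> (2 * max \<bar>a\<bar> \<bar>b\<bar>) powr p"
    using assms by (intro powr_mono2) auto
  also have "\<dots> = 2 powr p * max \<bar>a\<bar> \<bar>b\<bar> powr p"
    by (simp add: powr_mult)
  also have "\<dots> \<le> 2 powr p * (\<bar>a\<bar> powr p + \<bar>b\<bar> powr p)"
    by (intro mult_left_mono) (auto simp: max_def)
  finally show ?thesis .
qed

text \<open>
  A substitute for Clarkson's inequalities that treats \<open>p < 2\<close> and \<open>p \<ge> 2\<close> alike.  All terms are
  homogeneous of degree \<open>p\<close>, so it suffices to consider \<open>|a|^p + |b|^p = 1\<close>.  There the points with
  \<open>|a - b|^p \<ge> \<epsilon>\<close> form a compact set that avoids the diagonal, on which the strictly positive
  convexity gap \<open>D\<close> has a positive minimum.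
\<close>
lemma abs_powr_uniformly_convex:
  assumes p: "p > 1" and e: "\<epsilon> > 0"
  shows "\<exists>C\<ge>0. \<forall>a b :: real. \<bar>a - b\<bar> powr p \<le> \<epsilon> * (\<bar>a\<bar> powr p + \<bar>b\<bar> powr p) +
           C * ((\<bar>a\<bar> powr p + \<bar>b\<bar> powr p) / 2 - \<bar>(a + b) / 2\<bar> powr p)"
proof -
  define N where "N = (\<lambda>(a::real, b::real). \<bar>a\<bar> powr p + \<bar>b\<bar> powr p)"
  define D where "D = (\<lambda>(a::real, b::real). (\<bar>a\<bar> powr p + \<bar>b\<bar> powr p) / 2 - \<bar>(a + b) / 2\<bar> powr p)"
  define K where "K = {z. N z = 1 \<and> \<epsilon> \<le> (case z of (a, b) \<Rightarrow> \<bar>a - b\<bar> powr p)}"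
  have contN: "continuous_on UNIV N" and contD: "continuous_on UNIV D"
    and contd: "continuous_on UNIV (\<lambda>(a::real, b::real). \<bar>a - b\<bar> powr p)"
    using p unfolding N_def D_def case_prod_unfold
    by (auto intro!: continuous_intros continuous_on_powr')
  have D_nonneg: "D (a, b) \<ge> 0" for a b
    using abs_powr_midpoint_strict[OF p, of a b] by (cases "a = b") (auto simp: D_def abs_mult)
  have "closed K"
    unfolding K_def
    by (intro closed_Collect_conj closed_Collect_eq closed_Collect_le contN contd continuous_intros)
  moreover have "K \<subseteq> {-1..1} \<times> {-1..1}"
  proof
    fix z assume z: "z \<in> K"
    obtain a b where ab: "z = (a, b)" by (cases z)
    have le: "\<bar>c\<bar> \<le> 1" if "\<bar>c\<bar> powr p \<le> 1" for c :: real
    proof (rule ccontr)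
      assume "\<not> \<bar>c\<bar> \<le> 1"
      then have "1 powr p < \<bar>c\<bar> powr p" using p by (intro powr_less_mono2) auto
      with that show False by simp
    qed
    have "\<bar>a\<bar> powr p \<le> 1" "\<bar>b\<bar> powr p \<le> 1"
      using z powr_ge_zero[of "\<bar>a\<bar>" p] powr_ge_zero[of "\<bar>b\<bar>" p]
      by (auto simp: K_def N_def ab simp del: powr_ge_zero)
    then have "\<bar>a\<bar> \<le> 1" "\<bar>b\<bar> \<le> 1" by (auto intro: le)
    then show "z \<in> {-1..1} \<times> {-1..1}" by (auto simp: ab)
  qed
  ultimately have compK: "compact K"
    by (metis compact_Icc compact_Times compact_Int_closed inf.absorb2)
  obtain \<delta> where \<delta>: "\<delta> > 0" "\<And>z. z \<in> K \<Longrightarrow> \<delta> \<le> D z"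
  proof (cases "K = {}")
    case False
    then obtain z0 where z0: "z0 \<in> K" "\<And>z. z \<in> K \<Longrightarrow> D z0 \<le> D z"
      using continuous_attains_inf[OF compK False continuous_on_subset[OF contD]] by auto
    obtain a b where ab: "z0 = (a, b)" by (cases z0)
    then have "a \<noteq> b" using z0(1) e by (auto simp: K_def)
    then have "D z0 > 0"
      using abs_powr_midpoint_strict[OF p, of a b] by (simp add: D_def ab)
    with z0(2) that show ?thesis by blast
  qed (use that[of 1] in auto)
  \<comment> \<open>On the normalized set \<open>|a - b|^p\<close> never exceeds \<open>2^p\<close>, so this \<open>C\<close> makes \<open>C * D\<close> dominate it
    on \<open>K\<close>.\<close>
  define C where "C = 2 powr p / \<delta>"
  have normalized: "\<bar>a - b\<bar> powr p \<le> \<epsilon> + C * D (a, b)" if "N (a, b) = 1" for a b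
  proof (cases "(a, b) \<in> K")
    case True
    have "\<bar>a - b\<bar> powr p \<le> 2 powr p"
      using abs_add_powr_le[OF p, of a "- b"] that by (simp add: N_def)
    also have "\<dots> \<le> C * D (a, b)"
      using \<delta>(1) \<delta>(2)[OF True] by (simp add: C_def field_simps)
    finally show ?thesis using e by simp
  next
    case False
    then show ?thesis using that D_nonneg[of a b] \<delta>(1) by (auto simp: K_def C_def intro: add_increasing2)
  qed
  have "\<bar>a - b\<bar> powr p \<le> \<epsilon> * N (a, b) + C * D (a, b)" for a b :: real
  proof (cases "N (a, b) = 0")
    case True
    then have "a = 0" "b = 0" by (auto simp: N_def add_nonneg_eq_0_iff)
    then show ?thesis by (simp add: N_def D_def)
  next
    case False
    then have pos: "N (a, b) > 0" by (auto simp: N_def order.strict_iff_order)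
    define r where "r = N (a, b) powr (1 / p)"
    have r: "r > 0" "r powr p = N (a, b)" using pos p by (auto simp: r_def powr_powr)
    have scale: "\<bar>c / r\<bar> powr p = \<bar>c\<bar> powr p / N (a, b)" for c
      using r by (simp add: powr_divide)
    have avg: "(a / r + b / r) / 2 = ((a + b) / 2) / r" and dif: "a / r - b / r = (a - b) / r"
      by (simp_all add: add_divide_distrib diff_divide_distrib)
    have N1: "N (a / r, b / r) = N (a, b) / N (a, b)"
      unfolding N_def by (simp only: prod.case scale add_divide_distrib) (simp add: N_def)
    have D1: "D (a / r, b / r) = D (a, b) / N (a, b)"
      unfolding D_def by (simp only: prod.case scale avg) (simp add: diff_divide_distrib add_divide_distrib)
    have "\<bar>a - b\<bar> powr p / N (a, b) \<le> \<epsilon> + C * (D (a, b) / N (a, b))"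
      using normalized[of "a / r" "b / r"] N1 D1 pos scale[of "a - b"] dif by simp
    then show ?thesis using pos by (simp add: field_simps)
  qed
  then show ?thesis
    using \<delta>(1) by (intro exI[of _ C]) (auto simp: C_def N_def D_def)
qed

text \<open>
  A crude form of Young's inequality: compare \<open>|b|\<close> with \<open>\<eta> |a|\<close> and replace the smaller of the two
  by the larger one.  Since \<open>1 - p < 0\<close>, the second coefficient vanishes as \<open>\<eta>\<close> grows.
\<close>
lemma flux_mult_le:
  assumes p: "p > 1" and \<eta>: "\<eta> > 0"
  shows "\<bar>flux p a * b\<bar> \<le> \<eta> * \<bar>a\<bar> powr p + \<eta> powr (1 - p) * \<bar>b\<bar> powr p"
proof (cases "\<bar>b\<bar> \<le> \<eta> * \<bar>a\<bar>")
  case True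
  have "\<bar>flux p a * b\<bar> \<le> \<bar>flux p a\<bar> * (\<eta> * \<bar>a\<bar>)"
    using True by (simp add: abs_mult mult_left_mono)
  also have "\<dots> = \<eta> * \<bar>flux p a * a\<bar>"
    by (simp add: abs_mult)
  also have "\<dots> = \<eta> * \<bar>a\<bar> powr p"
    by (simp add: flux_mult_self)
  finally show ?thesis by (simp add: add_increasing2)
next
  case False
  then have ab: "\<bar>a\<bar> \<le> \<bar>b\<bar> / \<eta>" and b: "\<bar>b\<bar> > 0" using \<eta> 
    by (auto simp: field_simps)
  have "\<bar>flux p a * b\<bar> = \<bar>a\<bar> powr (p - 1) * \<bar>b\<bar>"
    by (simp add: abs_mult abs_flux)
  also have "\<dots> \<le> (\<bar>b\<bar> / \<eta>) powr (p - 1) * \<bar>b\<bar>"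
    using p ab by (intro mult_right_mono powr_mono2) auto
  also have "\<dots> = \<eta> powr (1 - p) * \<bar>b\<bar> powr p"
    using b \<eta> powr_mult_base[of "\<bar>b\<bar>" "p - 1"] powr_minus_divide[of \<eta> "p - 1"]
    by (simp add: powr_divide mult.commute)
  finally show ?thesis using \<eta> by (simp add: add_increasing)
qed

definition clip :: "real \<Rightarrow> real \<Rightarrow> real" where
  "clip M t = max (- M) (min M t)"

lemma clip_lipschitz: "\<bar>clip M s - clip M t\<bar> \<le> 1 * \<bar>s - t\<bar>"
  by (auto simp: clip_def max_def min_def)

lemma clip_id: "\<bar>t\<bar> \<le> M \<Longrightarrow> clip M t = t"
  by (auto simp: clip_def)

lemma abs_clip_le: "M \<ge> 0 \<Longrightarrow> \<bar>clip M t\<bar> \<le> M"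
  by (auto simp: clip_def)

lemma isCont_clip: "isCont (clip M) t"
  unfolding clip_def[abs_def] by (intro continuous_intros)

text \<open>
  Lipschitz functions act on functions of finite energy; this one provides reciprocals of functions
  that are bounded away from zero.
\<close>
lemma inverse_max_lipschitz:
  fixes c s t :: real
  assumes c: "c > 0"
  shows "\<bar>1 / max s c - 1 / max t c\<bar> \<le> 1 / c\<^sup>2 * \<bar>s - t\<bar>"
proof -
  define a where "a = max s c"
  define b where "b = max t c"
  have ab: "a \<ge> c" "b \<ge> c" by (auto simp: a_def b_def)
  with c have pos: "a > 0" "b > 0" by auto
  have "1 / a - 1 / b = (b - a) / (a * b)" using pos by (simp add: field_simps)
  then have "\<bar>1 / a - 1 / b\<bar> = \<bar>b - a\<bar> / (a * b)" using pos by (simp add: abs_mult)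
  also have "\<dots> \<le> \<bar>b - a\<bar> / (c * c)"
    using c ab by (intro divide_left_mono mult_mono) auto
  also have "\<dots> \<le> \<bar>s - t\<bar> / (c * c)"
    using c by (intro divide_right_mono) (auto simp: a_def b_def)
  finally show ?thesis by (simp add: a_def b_def power2_eq_square)
qed

section \<open>Separation axioms for function spaces\<close>

lemma open_eval: "open U \<Longrightarrow> open {h :: 'a \<Rightarrow> 'b::topological_space. h i \<in> U}"
  using product_topology_basis'[of "{i}" "\<lambda>_. U" "\<lambda>i. i"] by simp

text \<open>
  The characters form a subspace of a product over an uncountable index set, so their Hausdorff
  property does not come from a metric.  Different functions are separated at a coordinate where they
  differ.  The three axioms are established in increasing strength because the arities of a subclass
  must be compatible with those of its superclasses.
\<close>
instance "fun" :: (type, t0_space) t0_space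
proof
  fix f g :: "'a \<Rightarrow> 'b"
  assume "f \<noteq> g"
  then obtain i where i: "f i \<noteq> g i" by auto
  then obtain U where "open U" "\<not> (f i \<in> U \<longleftrightarrow> g i \<in> U)"
    using t0_space_class.t0_space[OF i] by auto
  then show "\<exists>U. open U \<and> \<not> (f \<in> U \<longleftrightarrow> g \<in> U)"
    by (intro exI[of _ "{h. h i \<in> U}"]) (auto simp: open_eval)
qed

instance "fun" :: (type, t1_space) t1_space
proof
  fix f g :: "'a \<Rightarrow> 'b"
  assume "f \<noteq> g"
  then obtain i where i: "f i \<noteq> g i" by auto
  then obtain U where "open U" "f i \<in> U" "g i \<notin> U"
    using t1_space_class.t1_space[OF i] by auto
  then show "\<exists>U. open U \<and> f \<in> U \<and> g \<notin> U"
    by (intro exI[of _ "{h. h i \<in> U}"]) (auto simp: open_eval)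
qed

instance "fun" :: (type, t2_space) t2_space
proof
  fix f g :: "'a \<Rightarrow> 'b"
  assume "f \<noteq> g"
  then obtain i where i: "f i \<noteq> g i" by auto
  then obtain U V where "open U" "open V" "f i \<in> U" "g i \<in> V" "U \<inter> V = {}"
    using hausdorff[OF i] by auto
  then show "\<exists>U V. open U \<and> open V \<and> f \<in> U \<and> g \<in> V \<and> U \<inter> V = {}"
    by (intro exI[of _ "{h. h i \<in> U}"] exI[of _ "{h. h i \<in> V}"]) (auto simp: open_eval)
qed

section \<open>Functions of finite energy on a graph\<close>

locale energy_graph =
  fixes E :: "'v \<Rightarrow> 'v \<Rightarrow> bool" and p :: real
  assumes p_gt_1: "p > 1"
    and symp_E: "symp E"
    and connected: "connected_graph E"
    and bounded_degree: "bounded_degree E"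
begin

abbreviation "N \<equiv> neighbors E"
abbreviation "loc \<equiv> local_energy E p"
abbreviation "en \<equiv> energy E p"
abbreviation "D \<equiv> Dp E p"
abbreviation "BD \<equiv> BDp E p"

lemma finite_neighbors [simp]: "finite (N x)"
  using bounded_degree by (auto simp: bounded_degree_def)

lemma neighbors_sym: "y \<in> N x \<longleftrightarrow> x \<in> N y"
  using symp_E by (auto simp: neighbors_def dest: sympD)

lemma loc_nonneg [simp]: "loc u x \<ge> 0"
  by (auto simp: local_energy_def intro: sum_nonneg)

lemma has_sum_energy: "u \<in> D \<Longrightarrow> (loc u has_sum en u) UNIV"
  by (simp add: Dp_def energy_def)

lemma energy_nonneg [simp]: "en u \<ge> 0"
  by (simp add: energy_def infsum_nonneg)

lemma sum_loc_le_energy: "u \<in> D \<Longrightarrow> finite F \<Longrightarrow> sum (loc u) F \<le> en u"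
  unfolding energy_def Dp_def by (intro finite_sum_le_infsum) auto

lemma edge_le_energy:
  assumes "u \<in> D" "E x y"
  shows "\<bar>u y - u x\<bar> powr p \<le> en u"
proof -
  have "\<bar>u y - u x\<bar> powr p \<le> loc u x"
    unfolding local_energy_def using assms(2)
    by (intro member_le_sum finite_neighbors) (auto simp: neighbors_def)
  also have "\<dots> \<le> en u"
    using sum_loc_le_energy[OF assms(1), of "{x}"] by simp
  finally show ?thesis .
qed

text \<open>
  All closure properties of the space of functions of finite energy are obtained from an
  inequality between local energies at each single vertex.
\<close>
lemma energy_dominated:
  assumes "v \<in> D" "w \<in> D" and le: "\<And>x. loc u x \<le> A * loc v x + B * loc w x"
  shows "u \<in> D" "en u \<le> A * en v + B * en w"
proof -
  have s: "((\<lambda>x. A * loc v x + B * loc w x) has_sum (A * en v + B * en w)) UNIV"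
    by (intro has_sum_add has_sum_cmult_right has_sum_energy assms)
  have "loc u summable_on UNIV"
    by (rule summable_on_comparison_test[OF has_sum_imp_summable[OF s]]) (auto simp: le)
  then show "u \<in> D" by (simp add: Dp_def)
  then show "en u \<le> A * en v + B * en w"
    using le by (intro has_sum_mono[OF has_sum_energy s]) auto
qed

lemma loc_add: "loc (\<lambda>x. u x + v x) x \<le> 2 powr p * loc u x + 2 powr p * loc v x"
proof -
  have "loc (\<lambda>x. u x + v x) x \<le> (\<Sum>y\<in>N x. 2 powr p * (\<bar>u y - u x\<bar> powr p + \<bar>v y - v x\<bar> powr p))"
    unfolding local_energy_def
    by (intro sum_mono) (metis abs_add_powr_le[OF p_gt_1] add_diff_add)
  then show ?thesis
    by (simp add: local_energy_def sum.distrib sum_distrib_left ring_distribs)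
qed

lemma loc_lipschitz:
  assumes "\<And>s t. \<bar>\<psi> s - \<psi> t\<bar> \<le> K * \<bar>s - t\<bar>" "K \<ge> 0"
  shows "loc (\<lambda>x. \<psi> (u x)) x \<le> K powr p * loc u x"
proof -
  have "loc (\<lambda>x. \<psi> (u x)) x \<le> (\<Sum>y\<in>N x. (K * \<bar>u y - u x\<bar>) powr p)"
    unfolding local_energy_def using p_gt_1 assms(1)
    by (intro sum_mono powr_mono2) auto
  also have "\<dots> = K powr p * loc u x"
    using assms(2) by (simp add: local_energy_def powr_mult sum_distrib_left)
  finally show ?thesis .
qed

text \<open>
  This is the product rule \<open>u(y) v(y) - u(x) v(x) = u(y) (v(y) - v(x)) + v(x) (u(y) - u(x))\<close>.
\<close>
lemma loc_mult:
  assumes u: "\<And>x. \<bar>u x\<bar> \<le> A" and v: "\<And>x. \<bar>v x\<bar> \<le> B"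
  shows "loc (\<lambda>x. u x * v x) x \<le> (2 * A) powr p * loc v x + (2 * B) powr p * loc u x"
proof -
  have "A \<ge> 0" "B \<ge> 0" using u[of undefined] v[of undefined] by linarith+
  have "\<bar>u y * v y - u x * v x\<bar> powr p
      \<le> 2 powr p * ((A * \<bar>v y - v x\<bar>) powr p + (B * \<bar>u y - u x\<bar>) powr p)" for y
  proof -
    have "\<bar>u y * v y - u x * v x\<bar> powr p = \<bar>u y * (v y - v x) + v x * (u y - u x)\<bar> powr p"
      by (simp add: algebra_simps)
    also have "\<dots> \<le> 2 powr p * (\<bar>u y * (v y - v x)\<bar> powr p + \<bar>v x * (u y - u x)\<bar> powr p)"
      by (rule abs_add_powr_le[OF p_gt_1])
    also have "\<dots> \<le> 2 powr p * ((A * \<bar>v y - v x\<bar>) powr p + (B * \<bar>u y - u x\<bar>) powr p)"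
      using p_gt_1 u v by (intro mult_left_mono add_mono powr_mono2) (auto simp: abs_mult mult_right_mono)
    finally show ?thesis .
  qed
  then have "loc (\<lambda>x. u x * v x) x \<le>
      (\<Sum>y\<in>N x. 2 powr p * ((A * \<bar>v y - v x\<bar>) powr p + (B * \<bar>u y - u x\<bar>) powr p))"
    unfolding local_energy_def by (intro sum_mono)
  also have "\<dots> = (2 * A) powr p * loc v x + (2 * B) powr p * loc u x"
    using \<open>A \<ge> 0\<close> \<open>B \<ge> 0\<close>
    by (simp add: local_energy_def powr_mult sum.distrib sum_distrib_left ring_distribs mult_ac)
  finally show ?thesis .
qed

lemma D_add:
  assumes "u \<in> D" "v \<in> D"
  shows "(\<lambda>x. u x + v x) \<in> D" "en (\<lambda>x. u x + v x) \<le> 2 powr p * en u + 2 powr p * en v"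
  using energy_dominated[OF assms loc_add] by auto

lemma D_lipschitz:
  assumes "u \<in> D" "\<And>s t. \<bar>\<psi> s - \<psi> t\<bar> \<le> K * \<bar>s - t\<bar>" "K \<ge> 0"
  shows "(\<lambda>x. \<psi> (u x)) \<in> D" "en (\<lambda>x. \<psi> (u x)) \<le> K powr p * en u"
proof -
  have "loc (\<lambda>x. \<psi> (u x)) x \<le> K powr p * loc u x + 0 * loc u x" for x
    using loc_lipschitz[of \<psi> K u x, OF assms(2,3)] by simp
  from energy_dominated[OF assms(1,1) this]
  show "(\<lambda>x. \<psi> (u x)) \<in> D" "en (\<lambda>x. \<psi> (u x)) \<le> K powr p * en u" by auto
qed

lemma D_cmult: "u \<in> D \<Longrightarrow> (\<lambda>x. c * u x) \<in> D"
  by (rule D_lipschitz[where K = "\<bar>c\<bar>"]) (auto simp: abs_mult[symmetric] ring_distribs)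

lemma D_diff: "u \<in> D \<Longrightarrow> v \<in> D \<Longrightarrow> (\<lambda>x. u x - v x) \<in> D"
  using D_add(1)[of u "\<lambda>x. -1 * v x"] D_cmult[of v "-1"] by simp

text \<open>
  A finitely supported function has nonzero increments only near its support, and by local
  finiteness only finitely many vertices are near it.
\<close>
lemma finsupp_in_D:
  assumes "g \<in> finsupp_funs"
  shows "g \<in> D"
proof -
  define T where "T = {x. g x \<noteq> 0} \<union> (\<Union>x\<in>{x. g x \<noteq> 0}. N x)"
  have T: "finite T" using assms by (auto simp: T_def finsupp_funs_def)
  have "loc g x = 0" if "x \<notin> T" for x
    unfolding local_energy_def
  proof (rule sum.neutral, intro ballI)
    fix y assume "y \<in> N x"
    with that have "g x = 0" "g y = 0" by (auto simp: T_def neighbors_sym[of x])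
    then show "\<bar>g y - g x\<bar> powr p = 0" by simp
  qed
  then have "loc g summable_on UNIV \<longleftrightarrow> loc g summable_on T"
    by (intro summable_on_cong_neutral) auto
  with T show ?thesis by (simp add: Dp_def)
qed

lemma BD_iff: "u \<in> BD \<longleftrightarrow> u \<in> D \<and> (\<exists>M. \<forall>x. \<bar>u x\<bar> \<le> M)"
  by (auto simp: BDp_def bounded_iff)

lemma BD_const: "(\<lambda>_. c) \<in> BD"
proof -
  have "loc (\<lambda>_. c) = (\<lambda>_. 0)" by (simp add: local_energy_def fun_eq_iff)
  then show ?thesis by (auto simp: BD_iff Dp_def)
qed

lemma BD_add: "u \<in> BD \<Longrightarrow> v \<in> BD \<Longrightarrow> (\<lambda>x. u x + v x) \<in> BD"
  unfolding BD_iff by (auto intro!: D_add) (meson abs_triangle_ineq add_mono order_trans)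

lemma BD_mult: "u \<in> BD \<Longrightarrow> v \<in> BD \<Longrightarrow> (\<lambda>x. u x * v x) \<in> BD"
proof -
  assume "u \<in> BD" "v \<in> BD"
  then obtain A B where *: "u \<in> D" "v \<in> D" "\<And>x. \<bar>u x\<bar> \<le> A" "\<And>x. \<bar>v x\<bar> \<le> B"
    by (auto simp: BD_iff)
  have "(\<lambda>x. u x * v x) \<in> D"
    using energy_dominated[OF *(2,1) loc_mult[OF *(3,4)]] by blast
  moreover have "\<bar>u x * v x\<bar> \<le> A * B" for x
    using mult_mono[OF *(3,4)[of x]] order_trans[OF abs_ge_zero *(3)] by (simp add: abs_mult)
  ultimately show ?thesis by (auto simp: BD_iff)
qed

lemma BD_cmult: "u \<in> BD \<Longrightarrow> (\<lambda>x. c * u x) \<in> BD"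
  using BD_mult[OF BD_const] .

lemma BD_diff: "u \<in> BD \<Longrightarrow> v \<in> BD \<Longrightarrow> (\<lambda>x. u x - v x) \<in> BD"
  using BD_add[of u "\<lambda>x. -1 * v x"] BD_cmult[of v "-1"] by simp

lemma BD_lipschitz:
  assumes "u \<in> BD" "\<And>s t. \<bar>\<psi> s - \<psi> t\<bar> \<le> K * \<bar>s - t\<bar>" "K \<ge> 0"
  shows "(\<lambda>x. \<psi> (u x)) \<in> BD"
proof -
  obtain M where M: "u \<in> D" "\<And>x. \<bar>u x\<bar> \<le> M" using assms(1) by (auto simp: BD_iff)
  have "\<bar>\<psi> (u x)\<bar> \<le> K * M + \<bar>\<psi> 0\<bar>" for x
  proof -
    have "\<bar>\<psi> (u x)\<bar> \<le> K * \<bar>u x\<bar> + \<bar>\<psi> 0\<bar>"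
      using assms(2)[of "u x" 0] by (simp add: abs_if split: if_splits)
    with mult_left_mono[OF M(2) assms(3), of x] show ?thesis by linarith
  qed
  with D_lipschitz(1)[OF M(1) assms(2,3)] show ?thesis by (auto simp: BD_iff)
qed

lemma connected_induct [case_names base edge]:
  assumes "P x" "\<And>y z. P y \<Longrightarrow> E y z \<Longrightarrow> P z"
  shows "P y"
proof -
  have "E\<^sup>*\<^sup>* x y" using connected by (simp add: connected_graph_def)
  then show ?thesis by (induction rule: rtranclp_induct) (use assms in auto)
qed

section \<open>Completeness and uniform convexity of the energy\<close>

text \<open>
  The energy controls the increment along each edge, so convergence propagates from one vertex to the
  whole connected graph.
\<close>
lemma tendsto_zero_of_energy:
  assumes w: "\<And>n. w n \<in> D" and e: "(\<lambda>n. en (w n)) \<longlonglongrightarrow> 0" and o: "(\<lambda>n. w n v0) \<longlonglongrightarrow> 0"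
  shows "(\<lambda>n. w n x) \<longlonglongrightarrow> 0"
proof (induction x rule: connected_induct[where x = v0])
  case (edge y z)
  have "(\<lambda>n. en (w n) powr (1 / p)) \<longlonglongrightarrow> 0"
    using tendsto_powr'[OF e tendsto_const, of "1 / p"] p_gt_1 by simp
  then have "(\<lambda>n. w n z - w n y) \<longlonglongrightarrow> 0"
  proof (rule Lim_null_comparison[rotated], intro always_eventually allI)
    fix n
    have "(\<bar>w n z - w n y\<bar> powr p) powr (1 / p) \<le> en (w n) powr (1 / p)"
      using edge_le_energy[OF w edge(2)] p_gt_1 by (intro powr_mono2) auto
    then show "norm (w n z - w n y) \<le> en (w n) powr (1 / p)"
      using p_gt_1 by (simp add: powr_powr)
  qed
  from tendsto_add[OF this edge(1)] show ?case by simp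
qed (rule o)

text \<open>
  The candidate limit is pointwise: increments along edges are Cauchy by the bound through the energy,
  and the values at \<open>v0\<close> are Cauchy by assumption.  Convergence in energy follows from Fatou's
  argument, letting the second index tend to infinity in sums over finite vertex sets.
\<close>
lemma D_complete:
  assumes k: "\<And>n. k n \<in> D"
    and cauchy: "\<And>e. e > 0 \<Longrightarrow> \<exists>n0. \<forall>m\<ge>n0. \<forall>n\<ge>n0. en (\<lambda>x. k m x - k n x) < e"
    and base: "Cauchy (\<lambda>n. k n v0)"
  obtains h where "h \<in> D" "\<And>x. (\<lambda>n. k n x) \<longlonglongrightarrow> h x" "(\<lambda>n. en (\<lambda>x. k n x - h x)) \<longlonglongrightarrow> 0"
proof -
  have C: "Cauchy (\<lambda>n. k n x)" for x
  proof (induction x rule: connected_induct[where x = v0])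
    case (edge y z)
    have "Cauchy (\<lambda>n. k n z - k n y)"
    proof (rule CauchyI)
      fix e :: real assume e: "e > 0"
      obtain n0 where n0: "\<And>m n. m \<ge> n0 \<Longrightarrow> n \<ge> n0 \<Longrightarrow> en (\<lambda>x. k m x - k n x) < e powr p"
        using cauchy[of "e powr p"] e by auto
      show "\<exists>M. \<forall>m\<ge>M. \<forall>n\<ge>M. norm (k m z - k m y - (k n z - k n y)) < e"
      proof (intro exI[of _ n0] allI impI)
        fix m n assume "n0 \<le> m" "n0 \<le> n"
        then have "\<bar>(k m z - k n z) - (k m y - k n y)\<bar> powr p < e powr p"
          using edge_le_energy[OF D_diff[OF k k] edge(2), of m n] n0[of m n] by simp
        then have "\<bar>(k m z - k n z) - (k m y - k n y)\<bar> < e"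
          using e p_gt_1 by (metis powr_less_cancel2 abs_ge_zero not_less order_trans
              powr_mono2 less_le_trans zero_less_one less_imp_le)
        then show "norm (k m z - k m y - (k n z - k n y)) < e"
          by (simp add: algebra_simps)
      qed
    qed
    with convergent_add[of "\<lambda>n. k n z - k n y" "\<lambda>n. k n y"] edge(1) show ?case
      by (simp add: Cauchy_convergent_iff)
  qed (rule base)
  then obtain h where h: "\<And>x. (\<lambda>n. k n x) \<longlonglongrightarrow> h x"
    unfolding Cauchy_convergent_iff convergent_def by metis
  have tail: "\<exists>n0. \<forall>n\<ge>n0. (\<lambda>x. k n x - h x) \<in> D \<and> en (\<lambda>x. k n x - h x) \<le> e" if e: "e > 0" for e
  proof -
    obtain n0 where n0: "\<And>m n. m \<ge> n0 \<Longrightarrow> n \<ge> n0 \<Longrightarrow> en (\<lambda>x. k m x - k n x) < e"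
      using cauchy[OF e] by auto
    have "(\<lambda>x. k n x - h x) \<in> D \<and> en (\<lambda>x. k n x - h x) \<le> e" if n: "n \<ge> n0" for n
    proof -
      have fin: "sum (loc (\<lambda>x. k n x - h x)) F \<le> e" if "finite F" for F
      proof (rule tendsto_upperbound)
        show "(\<lambda>m. sum (loc (\<lambda>x. k n x - k m x)) F) \<longlonglongrightarrow> sum (loc (\<lambda>x. k n x - h x)) F"
          unfolding local_energy_def using p_gt_1
          by (intro tendsto_sum tendsto_powr' tendsto_intros h) auto
        show "\<forall>\<^sub>F m in sequentially. sum (loc (\<lambda>x. k n x - k m x)) F \<le> e"
          using eventually_ge_at_top[of n0]
        proof eventually_elim
          case (elim m)
          show ?case
            using sum_loc_le_energy[OF D_diff[OF k k] that, of n m] n0[OF n elim] by simp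
        qed
      qed auto
      have s: "loc (\<lambda>x. k n x - h x) summable_on UNIV"
        by (rule nonneg_bdd_above_summable_on) (auto intro!: bdd_aboveI2[where M = e] fin)
      then show ?thesis
        using infsum_le_finite_sums[OF s, of e] fin by (auto simp: Dp_def energy_def)
    qed
    then show ?thesis by blast
  qed
  obtain n0 where "(\<lambda>x. k n0 x - h x) \<in> D" using tail[of 1] by auto
  from D_diff[OF k[of n0] this] have hD: "h \<in> D" by simp
  have "(\<lambda>n. en (\<lambda>x. k n x - h x)) \<longlonglongrightarrow> 0"
  proof (rule LIMSEQ_I)
    fix r :: real assume "r > 0"
    then obtain n0 where "\<And>n. n \<ge> n0 \<Longrightarrow> en (\<lambda>x. k n x - h x) \<le> r / 2" using tail[of "r / 2"] by auto
    with \<open>r > 0\<close> show "\<exists>no. \<forall>n\<ge>no. norm (en (\<lambda>x. k n x - h x) - 0) < r"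
      by (intro exI[of _ n0]) (force intro: le_less_trans[of _ "r / 2"])
  qed
  with hD h that show ?thesis by blast
qed

text \<open>
  This transfers the inequality for real numbers to the energy by summing it over all edges.  It is
  used for minimizing sequences, where the bracket multiplied by \<open>C\<close> becomes small.
\<close>
lemma energy_uniformly_convex:
  assumes "\<epsilon> > 0"
  shows "\<exists>C\<ge>0. \<forall>u\<in>D. \<forall>v\<in>D. en (\<lambda>x. u x - v x) \<le>
           \<epsilon> * (en u + en v) + C * ((en u + en v) / 2 - en (\<lambda>x. (u x + v x) / 2))"
proof -
  obtain C where C: "C \<ge> 0" "\<And>a b :: real. \<bar>a - b\<bar> powr p \<le> \<epsilon> * (\<bar>a\<bar> powr p + \<bar>b\<bar> powr p) +
           C * ((\<bar>a\<bar> powr p + \<bar>b\<bar> powr p) / 2 - \<bar>(a + b) / 2\<bar> powr p)"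
    using abs_powr_uniformly_convex[OF p_gt_1 assms] by blast
  have "en (\<lambda>x. u x - v x) \<le>
           \<epsilon> * (en u + en v) + C * ((en u + en v) / 2 - en (\<lambda>x. (u x + v x) / 2))"
    if "u \<in> D" "v \<in> D" for u v
  proof -
    define m where "m = (\<lambda>x. (u x + v x) / 2)"
    have m: "m \<in> D" using D_cmult[OF D_add(1)[OF that], of "1/2"] by (simp add: m_def)
    have le: "loc (\<lambda>x. u x - v x) x \<le> \<epsilon> * (loc u x + loc v x) + C * ((loc u x + loc v x) * (1/2) + -1 * loc m x)" for x
    proof -
      have "loc (\<lambda>x. u x - v x) x \<le> (\<Sum>y\<in>N x. \<epsilon> * (\<bar>u y - u x\<bar> powr p + \<bar>v y - v x\<bar> powr p) +
          C * ((\<bar>u y - u x\<bar> powr p + \<bar>v y - v x\<bar> powr p) / 2 - \<bar>m y - m x\<bar> powr p))"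
        unfolding local_energy_def
      proof (rule sum_mono)
        fix y
        have "u y - v y - (u x - v x) = (u y - u x) - (v y - v x)"
          and "m y - m x = ((u y - u x) + (v y - v x)) / 2" by (auto simp: m_def field_simps)
        then show "\<bar>u y - v y - (u x - v x)\<bar> powr p \<le> \<epsilon> * (\<bar>u y - u x\<bar> powr p + \<bar>v y - v x\<bar> powr p) +
          C * ((\<bar>u y - u x\<bar> powr p + \<bar>v y - v x\<bar> powr p) / 2 - \<bar>m y - m x\<bar> powr p)"
          using C(2)[of "u y - u x" "v y - v x"] by (simp only:)
      qed
      then show ?thesis
        by (simp add: local_energy_def sum.distrib sum_distrib_left[symmetric] sum_subtractf
            sum_divide_distrib[symmetric])
    qed
    have "((\<lambda>x. \<epsilon> * (loc u x + loc v x) + C * ((loc u x + loc v x) * (1/2) + -1 * loc m x)) has_sum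
        (\<epsilon> * (en u + en v) + C * ((en u + en v) * (1/2) + -1 * en m))) UNIV"
      by (intro has_sum_add has_sum_cmult_right has_sum_cmult_left has_sum_energy that m)
    from has_sum_mono[OF has_sum_energy[OF D_diff[OF that]] this] le
    show ?thesis by (simp add: m_def)
  qed
  with C(1) show ?thesis by blast
qed

section \<open>The pairing attached to the Laplacian\<close>

lemma p_laplacian_flux: "p_laplacian E p u x = (\<Sum>y\<in>N x. flux p (u y - u x))"
  by (simp add: p_laplacian_def flux_def)

lemma tendsto_p_laplacian:
  assumes "\<And>x. ((\<lambda>n. u n x) \<longlongrightarrow> v x) F"
  shows "((\<lambda>n. p_laplacian E p (u n) x) \<longlongrightarrow> p_laplacian E p v x) F"
  unfolding p_laplacian_flux
  by (intro tendsto_sum isCont_tendsto_compose[OF isCont_flux[OF p_gt_1]] tendsto_diff assms)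

text \<open>
  The sum over all vertices \<open>x\<close> is \<open>1 / p\<close> times the derivative of the energy at \<open>h\<close> in direction \<open>u\<close>.
\<close>
definition local_pairing :: "('v \<Rightarrow> real) \<Rightarrow> ('v \<Rightarrow> real) \<Rightarrow> 'v \<Rightarrow> real" where
  "local_pairing h u x = (\<Sum>y\<in>N x. flux p (h y - h x) * (u y - u x))"

lemma local_pairing_le:
  assumes "\<eta> > 0"
  shows "\<bar>local_pairing h u x\<bar> \<le> \<eta> * loc h x + \<eta> powr (1 - p) * loc u x"
proof -
  have "\<bar>local_pairing h u x\<bar> \<le> (\<Sum>y\<in>N x. \<bar>flux p (h y - h x) * (u y - u x)\<bar>)"
    unfolding local_pairing_def by (rule sum_abs)
  also have "\<dots> \<le> (\<Sum>y\<in>N x. \<eta> * \<bar>h y - h x\<bar> powr p + \<eta> powr (1 - p) * \<bar>u y - u x\<bar> powr p)"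
    by (intro sum_mono flux_mult_le p_gt_1 assms)
  finally show ?thesis
    by (simp add: local_energy_def sum.distrib sum_distrib_left)
qed

lemma summable_local_pairing:
  assumes "h \<in> D" "u \<in> D"
  shows "(\<lambda>x. norm (local_pairing h u x)) summable_on A"
    and "local_pairing h u summable_on A"
proof -
  have "(\<lambda>x. 1 * loc h x + 1 powr (1 - p) * loc u x) summable_on UNIV"
    using assms by (intro summable_on_add summable_on_cmult_right) (auto simp: Dp_def)
  then have "(\<lambda>x. norm (local_pairing h u x)) summable_on UNIV"
    by (rule summable_on_comparison_test) (use local_pairing_le[of 1 h u] in auto)
  then show "(\<lambda>x. norm (local_pairing h u x)) summable_on A"
    using summable_on_subset_banach by blast
  then show "local_pairing h u summable_on A"
    by (rule abs_summable_summable)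
qed

text \<open>
  Summation by parts.  Every edge is counted in both directions with opposite flux, so the two halves
  of the increment of \<open>g\<close> contribute equally; this is the factor 2.
\<close>
lemma has_sum_local_pairing_finsupp:
  assumes "g \<in> finsupp_funs"
  shows "(local_pairing h g has_sum - 2 * (\<Sum>x | g x \<noteq> 0. g x * p_laplacian E p h x)) UNIV"
proof -
  define S where "S = {x. g x \<noteq> 0}"
  \<comment> \<open>All edges with a nonzero increment of \<open>g\<close> have both ends in the finite set \<open>T\<close>.\<close>
  define T where "T = S \<union> (\<Union>x\<in>S. N x)"
  have S: "finite S" using assms by (simp add: S_def finsupp_funs_def)
  then have T: "finite T" by (simp add: T_def)
  have nz: "x \<in> T \<and> y \<in> T" if "y \<in> N x" "g y - g x \<noteq> 0" for x y
    using that by (auto simp: T_def S_def neighbors_sym[of x])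
  define c where "c x y = (if y \<in> N x then flux p (h y - h x) else 0)" for x y
  have anti: "c x y = - c y x" for x y
    using flux_minus[of p "h x - h y"] by (simp add: c_def neighbors_sym[of x])
  have row: "(\<Sum>y\<in>T. c x y * a y) = (\<Sum>y\<in>N x. flux p (h y - h x) * a y)"
    if "\<And>y. y \<in> N x \<Longrightarrow> y \<notin> T \<Longrightarrow> a y = 0" for x and a :: "'v \<Rightarrow> real"
    using T that by (intro sum.mono_neutral_cong) (auto simp: c_def)
  have lp: "local_pairing h g x = (\<Sum>y\<in>T. c x y * (g y - g x))" for x
    unfolding local_pairing_def using nz by (intro row[symmetric]) blast
  have lp0: "local_pairing h g x = 0" if "x \<notin> T" for x
    unfolding local_pairing_def using nz that by (intro sum.neutral) auto
  have "sum (local_pairing h g) T = (\<Sum>x\<in>T. \<Sum>y\<in>T. c x y * g y) - (\<Sum>x\<in>T. \<Sum>y\<in>T. c x y * g x)"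
    by (simp add: lp right_diff_distrib sum_subtractf)
  also have "(\<Sum>x\<in>T. \<Sum>y\<in>T. c x y * g y) = (\<Sum>x\<in>T. \<Sum>y\<in>T. c y x * g x)"
    by (rule sum.swap)
  also have "\<dots> = - (\<Sum>x\<in>T. \<Sum>y\<in>T. c x y * g x)"
    by (subst anti) (simp add: sum_negf)
  also have "(\<Sum>x\<in>T. \<Sum>y\<in>T. c x y * g x) = (\<Sum>x\<in>S. \<Sum>y\<in>T. c x y * g x)"
    using T by (intro sum.mono_neutral_right) (auto simp: T_def S_def)
  also have "\<dots> = (\<Sum>x\<in>S. g x * p_laplacian E p h x)"
  proof (rule sum.cong[OF refl])
    fix x assume "x \<in> S"
    then have "(\<Sum>y\<in>T. c x y * g x) = (\<Sum>y\<in>N x. flux p (h y - h x) * g x)"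
      by (intro row) (auto simp: T_def)
    then show "(\<Sum>y\<in>T. c x y * g x) = g x * p_laplacian E p h x"
      by (simp add: p_laplacian_flux sum_distrib_left mult.commute)
  qed
  finally have "sum (local_pairing h g) T = - 2 * (\<Sum>x\<in>S. g x * p_laplacian E p h x)" by simp
  moreover have "(local_pairing h g has_sum sum (local_pairing h g) T) UNIV"
    using has_sum_cong_neutral[of UNIV T "local_pairing h g" "local_pairing h g"] lp0
      has_sum_finite[OF T, of "local_pairing h g"] by auto
  ultimately show ?thesis by (simp add: S_def)
qed

text \<open>
  Convexity of the energy in directions of finite support.  The linear term is the pairing, written
  through the Laplacian by summation by parts.
\<close>
lemma energy_above_tangent:
  assumes "h \<in> D" "g \<in> finsupp_funs"
  shows "en h - 2 * p * (\<Sum>x | g x \<noteq> 0. g x * p_laplacian E p h x) \<le> en (\<lambda>x. h x + g x)"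
proof -
  have le: "loc h x + p * local_pairing h g x \<le> loc (\<lambda>x. h x + g x) x" for x
  proof -
    have "loc h x + p * local_pairing h g x =
        (\<Sum>y\<in>N x. \<bar>h y - h x\<bar> powr p + p * flux p (h y - h x) * (h y + g y - (h x + g x) - (h y - h x)))"
      by (simp add: local_energy_def local_pairing_def sum.distrib sum_distrib_left mult.assoc)
    also have "\<dots> \<le> loc (\<lambda>x. h x + g x) x"
      unfolding local_energy_def by (intro sum_mono abs_powr_above_tangent p_gt_1)
    finally show ?thesis .
  qed
  from has_sum_mono[OF has_sum_add[OF has_sum_energy[OF assms(1)]
      has_sum_cmult_right[OF has_sum_local_pairing_finsupp[OF assms(2)]]]
      has_sum_energy[OF D_add(1)[OF assms(1) finsupp_in_D[OF assms(2)]]] le]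
  show ?thesis by (simp add: algebra_simps)
qed

section \<open>Weak limits of finitely supported functions\<close>

lemma D_clip: "u \<in> D \<Longrightarrow> (\<lambda>x. clip M (u x)) \<in> D" "u \<in> D \<Longrightarrow> en (\<lambda>x. clip M (u x)) \<le> en u"
  using D_lipschitz[of u "clip M" 1] clip_lipschitz[of M] by auto

lemma Dp_norm_tendsto_zeroD:
  assumes w: "\<And>n. w n \<in> D" and lim: "(\<lambda>n. Dp_norm E p v0 (w n)) \<longlonglongrightarrow> 0"
  shows "(\<lambda>n. en (w n)) \<longlonglongrightarrow> 0" "(\<lambda>n. w n x) \<longlonglongrightarrow> 0"
proof -
  have "(\<lambda>n. Dp_norm E p v0 (w n) powr p) \<longlonglongrightarrow> 0"
    using tendsto_powr'[OF lim tendsto_const, of p] p_gt_1 by (simp add: Dp_norm_def)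
  moreover have "Dp_norm E p v0 (w n) powr p = en (w n) + \<bar>w n v0\<bar> powr p" for n
    using p_gt_1 by (simp add: Dp_norm_def powr_powr add_nonneg_nonneg)
  ultimately have lim': "(\<lambda>n. en (w n) + \<bar>w n v0\<bar> powr p) \<longlonglongrightarrow> 0" by simp
  show e: "(\<lambda>n. en (w n)) \<longlonglongrightarrow> 0"
    by (rule Lim_null_comparison[OF _ lim']) (auto intro: always_eventually)
  have "(\<lambda>n. \<bar>w n v0\<bar> powr p) \<longlonglongrightarrow> 0"
    by (rule Lim_null_comparison[OF _ lim']) (auto intro: always_eventually)
  from tendsto_powr'[OF this tendsto_const, of "1 / p"]
  have "(\<lambda>n. \<bar>w n v0\<bar>) \<longlonglongrightarrow> 0" using p_gt_1 by (simp add: powr_powr)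
  then have "(\<lambda>n. w n v0) \<longlonglongrightarrow> 0" by (simp add: tendsto_rabs_zero_iff)
  from tendsto_zero_of_energy[OF w e this] show "(\<lambda>n. w n x) \<longlonglongrightarrow> 0" .
qed

text \<open>
  A weak form of membership in the closure of the finitely supported functions.  Bounded energy
  together with pointwise convergence is all that the pairing with a harmonic function sees.  In
  contrast to norm convergence, this notion passes directly to truncations of the approximating
  functions, hence to products with elements of \<open>BDp E p\<close>.
\<close>
definition weak_null :: "('v \<Rightarrow> real) \<Rightarrow> bool" where
  "weak_null u \<longleftrightarrow> (\<exists>g C. (\<forall>n::nat. g n \<in> finsupp_funs \<and> en (g n) \<le> C) \<and>
                          (\<forall>x. (\<lambda>n. g n x) \<longlonglongrightarrow> u x))"

lemma finsupp_funs_subset: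
  "g \<in> finsupp_funs \<Longrightarrow> (\<And>x. g x = 0 \<Longrightarrow> h x = 0) \<Longrightarrow> h \<in> finsupp_funs"
  unfolding finsupp_funs_def by (auto elim!: rev_finite_subset)

lemma finsupp_funs_add:
  "g \<in> finsupp_funs \<Longrightarrow> h \<in> finsupp_funs \<Longrightarrow> (\<lambda>x. g x + h x) \<in> finsupp_funs"
  unfolding finsupp_funs_def mem_Collect_eq
  by (rule finite_subset[of _ "{x. g x \<noteq> 0} \<union> {x. h x \<noteq> 0}"]) auto

lemma weak_null_closure:
  assumes "u \<in> finsupp_closure E p v0"
  shows "weak_null u"
proof -
  have u: "u \<in> D" and app: "\<And>e. e > 0 \<Longrightarrow> \<exists>g\<in>finsupp_funs. Dp_norm E p v0 (\<lambda>x. u x - g x) < e"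
    using assms by (auto simp: finsupp_closure_def)
  have "\<forall>n. \<exists>g\<in>finsupp_funs. Dp_norm E p v0 (\<lambda>x. u x - g x) < 1 / real (Suc n)"
    by (intro allI app) auto
  then obtain g where g: "\<And>n. g n \<in> finsupp_funs"
      "\<And>n. Dp_norm E p v0 (\<lambda>x. u x - g n x) < 1 / real (Suc n)" by metis
  have w: "(\<lambda>x. u x - g n x) \<in> D" for n
    by (intro D_diff u finsupp_in_D g)
  have lim: "(\<lambda>n. Dp_norm E p v0 (\<lambda>x. u x - g n x)) \<longlonglongrightarrow> 0"
  proof (rule Lim_null_comparison[OF _ LIMSEQ_inverse_real_of_nat], intro always_eventually allI)
    fix n
    show "norm (Dp_norm E p v0 (\<lambda>x. u x - g n x)) \<le> inverse (real (Suc n))"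
      using less_imp_le[OF g(2)[of n]] by (simp add: Dp_norm_def inverse_eq_divide)
  qed
  have e: "(\<lambda>n. en (\<lambda>x. u x - g n x)) \<longlonglongrightarrow> 0" and pt: "\<And>x. (\<lambda>n. u x - g n x) \<longlonglongrightarrow> 0"
    using Dp_norm_tendsto_zeroD[OF w lim] by auto
  obtain B where B: "\<And>n. en (\<lambda>x. u x - g n x) \<le> B"
    using convergent_imp_Bseq[OF convergentI[OF e]] by (auto simp: Bseq_def)
  have "en (g n) \<le> 2 powr p * en u + 2 powr p * B" for n
  proof -
    have "en (g n) \<le> 2 powr p * en u + 2 powr p * en (\<lambda>x. - (u x - g n x))"
      using D_add(2)[OF u D_cmult[OF w, of "-1"], of n] by simp
    also have "en (\<lambda>x. - (u x - g n x)) = en (\<lambda>x. u x - g n x)"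
      unfolding energy_def local_energy_def
      by (intro infsum_cong sum.cong refl) (simp add: abs_minus_commute algebra_simps)
    also have "2 powr p * en (\<lambda>x. u x - g n x) \<le> 2 powr p * B"
      by (intro mult_left_mono B) simp
    finally show ?thesis by simp
  qed
  moreover have "(\<lambda>n. g n x) \<longlonglongrightarrow> u x" for x
    using tendsto_diff[OF tendsto_const[of "u x"] pt[of x]] by simp
  ultimately show ?thesis
    using g(1) unfolding weak_null_def by blast
qed

lemma weak_null_zero: "weak_null (\<lambda>_. 0)"
  unfolding weak_null_def
  by (rule exI[of _ "\<lambda>_ _. 0"], rule exI[of _ "en (\<lambda>_. 0)"]) (auto simp: finsupp_funs_def)

lemma weak_null_add:
  assumes "weak_null u" "weak_null v"
  shows "weak_null (\<lambda>x. u x + v x)"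
proof -
  obtain g A h B where g: "\<And>n. g n \<in> finsupp_funs" "\<And>n. en (g n) \<le> A" "\<And>x. (\<lambda>n. g n x) \<longlonglongrightarrow> u x"
    and h: "\<And>n. h n \<in> finsupp_funs" "\<And>n. en (h n) \<le> B" "\<And>x. (\<lambda>n. h n x) \<longlonglongrightarrow> v x"
    using assms unfolding weak_null_def by metis
  have "en (\<lambda>x. g n x + h n x) \<le> 2 powr p * A + 2 powr p * B" for n
    by (rule order_trans[OF D_add(2)[OF finsupp_in_D[OF g(1)] finsupp_in_D[OF h(1)]]])
       (intro add_mono mult_left_mono g h; simp)
  then show ?thesis
    unfolding weak_null_def using finsupp_funs_add[OF g(1) h(1)] tendsto_add[OF g(3) h(3)]
    by (intro exI[of _ "\<lambda>n x. g n x + h n x"]) blast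
qed

text \<open>
  The product rule for local energies needs bounded factors, so the approximating functions are
  truncated at a bound for \<open>u\<close>.  Truncation does not increase the energy, keeps the support
  finite, and does not change the pointwise limit.
\<close>
lemma weak_null_mult:
  assumes "weak_null u" and bdd: "\<And>x. \<bar>u x\<bar> \<le> M" and v: "v \<in> BD"
  shows "weak_null (\<lambda>x. u x * v x)"
proof -
  obtain g A where g: "\<And>n. g n \<in> finsupp_funs" "\<And>n. en (g n) \<le> A" "\<And>x. (\<lambda>n. g n x) \<longlonglongrightarrow> u x"
    using assms(1) unfolding weak_null_def by metis
  obtain B where vD: "v \<in> D" and B: "\<And>x. \<bar>v x\<bar> \<le> B" using v by (auto simp: BD_iff)
  have M: "M \<ge> 0" using bdd[of undefined] by linarith
  define c where "c n x = clip M (g n x)" for n x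
  have c_lim: "(\<lambda>n. c n x) \<longlonglongrightarrow> u x" for x
    using isCont_tendsto_compose[OF isCont_clip g(3), of M x] clip_id[OF bdd] by (simp add: c_def)
  have c_en: "c n \<in> D" "en (c n) \<le> A" for n
    using D_clip[OF finsupp_in_D[OF g(1)[of n]], of M] g(2)[of n] by (auto simp: c_def[abs_def])
  have c_le: "\<bar>c n x\<bar> \<le> M" for n x using abs_clip_le[OF M] by (simp add: c_def)
  have "en (\<lambda>x. c n x * v x) \<le> (2 * M) powr p * en v + (2 * B) powr p * A" for n
    by (rule order_trans[OF energy_dominated(2)[OF vD c_en(1) loc_mult[OF c_le[of n] B]]])
       (intro add_mono mult_left_mono c_en; simp)
  moreover have "(\<lambda>x. c n x * v x) \<in> finsupp_funs" for n
    by (rule finsupp_funs_subset[OF g(1)[of n]]) (use M in \<open>auto simp: c_def clip_def\<close>)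
  moreover have "(\<lambda>n. c n x * v x) \<longlonglongrightarrow> u x * v x" for x
    by (intro tendsto_mult c_lim tendsto_const)
  ultimately show ?thesis
    unfolding weak_null_def by (intro exI[of _ "\<lambda>n x. c n x * v x"]) blast
qed

text \<open>
  For the finitely supported approximations \<open>g n\<close> the pairing vanishes by summation by parts, so it
  may be computed with \<open>w n = u - g n\<close> in place of \<open>u\<close>.  Outside a finite set Young's inequality
  bounds the pairing by \<open>\<eta> powr (1 - p)\<close> times the bound \<open>C\<close> for the energies of all \<open>w n\<close>, plus
  \<open>\<eta>\<close> times a tail of the energy of \<open>h\<close>.  On the finite set the pairing tends to zero because
  \<open>w n\<close> does.
\<close>
lemma infsum_local_pairing_harmonic:
  assumes h: "h \<in> D" and harm: "p_harmonic E p h" and u: "u \<in> D" and null: "weak_null u"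
  shows "infsum (local_pairing h u) UNIV = 0"
proof -
  obtain g A where g: "\<And>n. g n \<in> finsupp_funs" "\<And>n. en (g n) \<le> A" "\<And>x. (\<lambda>n. g n x) \<longlonglongrightarrow> u x"
    using null unfolding weak_null_def by metis
  define w where "w n x = u x - g n x" for n x
  have gD: "g n \<in> D" for n by (intro finsupp_in_D g)
  have wD: "w n \<in> D" for n unfolding w_def[abs_def] by (intro D_diff u gD)
  define C where "C = 2 powr p * en u + 2 powr p * A"
  have w_en: "en (w n) \<le> C" for n
  proof -
    have "en (w n) \<le> 2 powr p * en u + 2 powr p * en (\<lambda>x. -1 * g n x)"
      using D_add(2)[OF u D_cmult[OF gD, of "-1"], of n] by (simp add: w_def[abs_def])
    also have "en (\<lambda>x. -1 * g n x) \<le> en (g n)"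
      using D_lipschitz(2)[OF gD, of "\<lambda>t. -1 * t" 1 n] by auto
    finally show ?thesis using g(2)[of n] unfolding C_def
      by (smt (verit) mult_left_mono powr_ge_zero)
  qed
  have w_lim: "(\<lambda>n. w n x) \<longlonglongrightarrow> 0" for x
    unfolding w_def using tendsto_diff[OF tendsto_const g(3)[of x], of "u x"] by simp
  let ?P = "infsum (local_pairing h u) UNIV"
  have P_eq: "?P = infsum (local_pairing h (w n)) UNIV" for n
  proof -
    have "(local_pairing h (g n) has_sum 0) UNIV"
      using has_sum_local_pairing_finsupp[OF g(1), of h n] harm by (simp add: p_harmonic_def)
    from has_sum_add[OF has_sum_infsum[OF summable_local_pairing(2)[OF h wD[of n], of UNIV]] this]
    have "((\<lambda>x. local_pairing h (w n) x + local_pairing h (g n) x) has_sum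
           infsum (local_pairing h (w n)) UNIV) UNIV" by simp
    also have "(\<lambda>x. local_pairing h (w n) x + local_pairing h (g n) x) = local_pairing h u"
      by (auto simp: local_pairing_def w_def fun_eq_iff sum.distrib[symmetric] algebra_simps intro!: sum.cong)
    finally show ?thesis by (rule infsumI)
  qed
  have bound: "\<bar>?P\<bar> \<le> \<eta> * e + \<eta> powr (1 - p) * C" if \<eta>: "\<eta> > 0" and e: "e > 0" for \<eta> e
  proof -
    obtain F where F: "finite F" "en h - sum (loc h) F \<le> e"
      using infsum_finite_approximation[of "loc h" UNIV e] h e
      by (auto simp: Dp_def energy_def dist_real_def)
    have sumD: "loc v summable_on A" if "v \<in> D" for v A
      using that summable_on_subset_banach by (auto simp: Dp_def)
    have tail: "infsum (loc v) (- F) = en v - sum (loc v) F" if "v \<in> D" for v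
      using infsum_Un_disjoint[of "loc v" F "- F"] sumD[OF that] F(1)
      by (simp add: energy_def)
    have step: "\<bar>?P\<bar> \<le> \<bar>sum (local_pairing h (w n)) F\<bar> + (\<eta> * e + \<eta> powr (1 - p) * C)" for n
    proof -
      have "?P = sum (local_pairing h (w n)) F + infsum (local_pairing h (w n)) (- F)"
        using infsum_Un_disjoint[of "local_pairing h (w n)" F "- F"]
          summable_local_pairing(2)[OF h wD] F(1) by (simp add: P_eq[of n])
      moreover have "\<bar>infsum (local_pairing h (w n)) (- F)\<bar> \<le>
          infsum (\<lambda>x. \<eta> * loc h x + \<eta> powr (1 - p) * loc (w n) x) (- F)"
      proof -
        have "\<bar>infsum (local_pairing h (w n)) (- F)\<bar> \<le> infsum (\<lambda>x. norm (local_pairing h (w n) x)) (- F)"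
          using norm_infsum_bound[OF summable_local_pairing(1)[OF h wD]] by simp
        also have "\<dots> \<le> infsum (\<lambda>x. \<eta> * loc h x + \<eta> powr (1 - p) * loc (w n) x) (- F)"
          using local_pairing_le[OF \<eta>] sumD[OF h] sumD[OF wD]
          by (intro infsum_mono summable_local_pairing h wD summable_on_add summable_on_cmult_right) auto
        finally show ?thesis .
      qed
      moreover have "infsum (\<lambda>x. \<eta> * loc h x + \<eta> powr (1 - p) * loc (w n) x) (- F)
          = \<eta> * infsum (loc h) (- F) + \<eta> powr (1 - p) * infsum (loc (w n)) (- F)"
        using sumD[OF h] sumD[OF wD]
        by (simp add: infsum_add summable_on_cmult_right infsum_cmult_right)
      moreover have "\<eta> * infsum (loc h) (- F) \<le> \<eta> * e"
        using \<eta> F(2) by (simp add: tail[OF h])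
      moreover have "\<eta> powr (1 - p) * infsum (loc (w n)) (- F) \<le> \<eta> powr (1 - p) * C"
        using w_en[of n] sum_nonneg[of F "loc (w n)"] by (intro mult_left_mono) (auto simp: tail[OF wD])
      ultimately show ?thesis by linarith
    qed
    have "(\<lambda>n. \<bar>sum (local_pairing h (w n)) F\<bar> + (\<eta> * e + \<eta> powr (1 - p) * C)) \<longlonglongrightarrow>
        \<bar>sum (\<lambda>x. \<Sum>y\<in>N x. flux p (h y - h x) * (0 - 0)) F\<bar> + (\<eta> * e + \<eta> powr (1 - p) * C)"
      unfolding local_pairing_def by (intro tendsto_intros w_lim)
    then show ?thesis
      using step by (intro LIMSEQ_le_const) auto
  qed
  \<comment> \<open>The finite set may be enlarged for fixed \<open>\<eta>\<close>; only then does \<open>\<eta>\<close> tend to infinity.\<close>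
  have bound': "\<bar>?P\<bar> \<le> \<eta> powr (1 - p) * C" if "\<eta> > 0" for \<eta>
  proof (rule field_le_epsilon)
    fix d :: real assume "d > 0"
    then show "\<bar>?P\<bar> \<le> \<eta> powr (1 - p) * C + d"
      using bound[OF that, of "d / \<eta>"] that by simp
  qed
  have "((\<lambda>\<eta>::real. \<eta> powr (1 - p) * C) \<longlongrightarrow> 0 * C) at_top"
    using p_gt_1 by (intro tendsto_mult tendsto_const tendsto_neg_powr filterlim_ident) auto
  then have "\<bar>?P\<bar> \<le> 0"
    by (intro tendsto_lowerbound[of "\<lambda>\<eta>. \<eta> powr (1 - p) * C" 0 at_top])
       (auto intro: eventually_mono[OF eventually_gt_at_top[of 0]] bound')
  then show ?thesis by simp
qed

text \<open>
  Let \<open>u\<close> be the excess \<open>max (h1 - h2 - c) 0\<close>.  It is a nondecreasing function of \<open>h1 - h2\<close>, and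
  the flux is strictly increasing, so along each edge the difference of the fluxes of \<open>h1\<close> and \<open>h2\<close>
  times the increment of \<open>u\<close> is nonnegative, and it is zero only if \<open>u\<close> does not change along that
  edge.  The sum of all these products is zero because both harmonic functions pair to zero with \<open>u\<close>.
\<close>
lemma excess_weak_null_const:
  assumes h: "h1 \<in> D" "p_harmonic E p h1" "h2 \<in> D" "p_harmonic E p h2"
    and null: "weak_null (\<lambda>x. max (h1 x - h2 x - c) 0)"
  shows "max (h1 x - h2 x - c) 0 = max (h1 y - h2 y - c) 0"
proof -
  define u where "u x = max (h1 x - h2 x - c) 0" for x
  have u: "u \<in> D"
    unfolding u_def[abs_def]
    by (rule D_lipschitz(1)[OF D_diff[OF h(1,3)], of "\<lambda>t. max (t - c) 0" 1]) auto
  define q where "q x y = (flux p (h1 y - h1 x) - flux p (h2 y - h2 x)) * (u y - u x)" for x y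
  have q: "q x y \<ge> 0 \<and> (q x y = 0 \<longrightarrow> u x = u y)" for x y
  proof -
    define a where "a = h1 y - h1 x"
    define b where "b = h2 y - h2 x"
    have ab: "a - b = (h1 y - h2 y) - (h1 x - h2 x)" by (simp add: a_def b_def)
    consider "a < b" | "a = b" | "b < a" by linarith
    then show ?thesis
    proof cases
      case 1
      then have "flux p a - flux p b < 0" "u y - u x \<le> 0"
        using flux_strict_mono[OF p_gt_1] ab by (auto simp: u_def)
      then show ?thesis
        unfolding q_def a_def[symmetric] b_def[symmetric] by (auto intro: mult_nonpos_nonpos)
    next
      case 2
      with ab show ?thesis by (simp add: q_def u_def)
    next
      case 3
      then have "flux p a - flux p b > 0" "u y - u x \<ge> 0"
        using flux_strict_mono[OF p_gt_1] ab by (auto simp: u_def)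
      then show ?thesis
        unfolding q_def a_def[symmetric] b_def[symmetric] by auto
    qed
  qed
  have null': "weak_null u" using null by (simp add: u_def[abs_def])
  have lp: "local_pairing h1 u x - local_pairing h2 u x = (\<Sum>y\<in>N x. q x y)" for x
    by (simp add: local_pairing_def q_def left_diff_distrib sum_subtractf)
  have "(local_pairing h1 u has_sum 0) UNIV" "(local_pairing h2 u has_sum 0) UNIV"
    using infsum_local_pairing_harmonic[OF h(1,2) u null'] infsum_local_pairing_harmonic[OF h(3,4) u null']
      has_sum_infsum[OF summable_local_pairing(2)[OF h(1) u, of UNIV]]
      has_sum_infsum[OF summable_local_pairing(2)[OF h(3) u, of UNIV]] by auto
  from has_sum_add[OF this(1) has_sum_cmult_right[OF this(2), of "-1"]]
  have "((\<lambda>x. local_pairing h1 u x - local_pairing h2 u x) has_sum 0) UNIV" by simp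
  then have "((\<lambda>x. \<Sum>y\<in>N x. q x y) has_sum 0) UNIV" by (simp add: lp)
  then have zero: "(\<Sum>y\<in>N x. q x y) = 0" for x
    by (rule nonneg_has_sum_le_0D) (auto intro!: sum_nonneg simp: q)
  have "u x = u y" if "E x y" for x y
  proof -
    have "q x y = 0"
      using sum_nonneg_eq_0_iff[of "N x" "q x"] zero[of x] that q by (simp add: neighbors_def[of E x, symmetric]) (simp add: neighbors_def)
    with q show ?thesis by blast
  qed
  then have "u y = u x"
    by (induction y rule: connected_induct[where x = x]) auto
  then show ?thesis by (simp add: u_def)
qed

section \<open>The Royden decomposition\<close>

text \<open>
  The harmonic part of \<open>f\<close> minimizes the energy over all limits of \<open>f - g\<close> with \<open>g\<close> of finite
  support.  A minimizing sequence can be truncated at a bound of \<open>f\<close>, since this changes \<open>f - g\<close> only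
  on the support of \<open>g\<close>.  Midpoints of members of the sequence are admissible too, hence have energy at
  least the infimum \<open>m\<close>, and uniform convexity makes the sequence Cauchy.  The limit satisfies the
  Euler-Lagrange equation, which is \<open>p\<close>-harmonicity.
\<close>
lemma harmonic_part:
  assumes f: "f \<in> BD"
  obtains h where "h \<in> BD" "p_harmonic E p h" "(\<lambda>x. f x - h x) \<in> bdd_finsupp_closure E p v0"
proof -
  obtain M where fD: "f \<in> D" and M: "\<And>x. \<bar>f x\<bar> \<le> M" using f by (auto simp: BD_iff)
  have M0: "M \<ge> 0" using M[of undefined] by linarith
  define J where "J g = en (\<lambda>x. f x - g x)" for g
  define m where "m = Inf (J ` finsupp_funs)"
  have bdd: "bdd_below (J ` finsupp_funs)" by (rule bdd_belowI[of _ 0]) (auto simp: J_def)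
  have ne: "J ` finsupp_funs \<noteq> {}" by (auto simp: finsupp_funs_def intro: exI[of _ "\<lambda>_. 0"])
  have m_le: "m \<le> en w" if "(\<lambda>x. f x - w x) \<in> finsupp_funs" for w
  proof -
    have "m \<le> J (\<lambda>x. f x - w x)" unfolding m_def by (intro cInf_lower bdd imageI that)
    then show ?thesis by (simp add: J_def)
  qed
  have "\<exists>g\<in>finsupp_funs. J g < m + 1 / real (Suc n)" for n
    using cInf_lessD[OF ne, of "m + 1 / real (Suc n)"] by (auto simp: m_def)
  then obtain \<gamma> where \<gamma>: "\<And>n. \<gamma> n \<in> finsupp_funs" "\<And>n. J (\<gamma> n) < m + 1 / real (Suc n)" by metis
  define k where "k n x = clip M (f x - \<gamma> n x)" for n x
  have kD: "k n \<in> D" for n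
    unfolding k_def[abs_def] by (intro D_clip D_diff fD finsupp_in_D \<gamma>)
  have k_le: "\<bar>k n x\<bar> \<le> M" for n x using abs_clip_le[OF M0] by (simp add: k_def)
  have k_fs: "(\<lambda>x. f x - k n x) \<in> finsupp_funs" for n
    by (rule finsupp_funs_subset[OF \<gamma>(1)[of n]]) (use clip_id[OF M] in \<open>simp add: k_def\<close>)
  have k_en: "m \<le> en (k n)" "en (k n) < m + 1 / real (Suc n)" for n
  proof -
    show "m \<le> en (k n)" by (intro m_le k_fs)
    have "en (k n) \<le> J (\<gamma> n)"
      unfolding J_def k_def[abs_def] by (intro D_clip D_diff fD finsupp_in_D \<gamma>)
    with \<gamma>(2)[of n] show "en (k n) < m + 1 / real (Suc n)" by linarith
  qed
  have "m \<ge> 0" unfolding m_def using ne by (intro cInf_greatest) (auto simp: J_def)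
  have k_lim: "(\<lambda>n. en (k n)) \<longlonglongrightarrow> m"
  proof (rule tendsto_sandwich[of "\<lambda>_. m" _ _ "\<lambda>n. m + inverse (real (Suc n))"])
    show "(\<lambda>n. m + inverse (real (Suc n))) \<longlonglongrightarrow> m"
      using tendsto_add[OF tendsto_const LIMSEQ_inverse_real_of_nat, of m] by simp
  qed (use k_en in \<open>auto intro!: always_eventually less_imp_le simp: inverse_eq_divide\<close>)
  \<comment> \<open>The energy does not see constants, so convergence at the base vertex has to be arranged
    separately.\<close>
  obtain r :: "nat \<Rightarrow> nat" where r: "strict_mono r" "convergent (\<lambda>n. k (r n) v0)"
  proof -
    have "bounded (range (\<lambda>n. k n v0))" using k_le by (auto simp: bounded_iff)
    from bounded_imp_convergent_subsequence[OF this] that show ?thesis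
      by (auto simp: convergent_def o_def)
  qed
  have midpoint: "m \<le> en (\<lambda>x. (k a x + k b x) / 2)" for a b
  proof (rule m_le)
    have "(\<lambda>x. (f x - k a x) + (f x - k b x)) \<in> finsupp_funs"
      by (intro finsupp_funs_add k_fs)
    then show "(\<lambda>x. f x - (k a x + k b x) / 2) \<in> finsupp_funs"
      by (rule finsupp_funs_subset) (auto simp: field_simps)
  qed
  have cauchy: "\<exists>n0. \<forall>a\<ge>n0. \<forall>b\<ge>n0. en (\<lambda>x. k (r a) x - k (r b) x) < e" if e: "e > 0" for e
  proof -
    \<comment> \<open>Once the energies are below \<open>m + 1\<close>, the first term of the convexity inequality is at most
      \<open>e / 2\<close>, and once they are below \<open>m + d\<close>, the second one is less than \<open>e / 2\<close>.\<close>
    define \<epsilon> where "\<epsilon> = e / (4 * (m + 1))"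
    have \<epsilon>: "\<epsilon> > 0" using e \<open>m \<ge> 0\<close> by (simp add: \<epsilon>_def)
    obtain C where C: "C \<ge> 0" "\<And>u v. u \<in> D \<Longrightarrow> v \<in> D \<Longrightarrow> en (\<lambda>x. u x - v x) \<le>
           \<epsilon> * (en u + en v) + C * ((en u + en v) / 2 - en (\<lambda>x. (u x + v x) / 2))"
      using energy_uniformly_convex[OF \<epsilon>] by blast
    define d where "d = e / (2 * (C + 1))"
    have d: "d > 0" using e C by (simp add: d_def)
    have "\<forall>\<^sub>F n in sequentially. en (k (r n)) < m + min 1 d"
      using order_tendstoD(2)[OF LIMSEQ_subseq_LIMSEQ[OF k_lim r(1)], of "m + min 1 d"] d by (simp add: o_def)
    then obtain n0 where n0: "\<And>n. n \<ge> n0 \<Longrightarrow> en (k (r n)) < m + min 1 d"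
      by (auto simp: eventually_sequentially)
    show ?thesis
    proof (intro exI[of _ n0] allI impI)
      fix a b assume "n0 \<le> a" "n0 \<le> b"
      then have ab: "en (k (r a)) < m + 1" "en (k (r b)) < m + 1"
          "en (k (r a)) < m + d" "en (k (r b)) < m + d"
        using n0[of a] n0[of b] by (auto simp: min_def split: if_splits)
      have "en (\<lambda>x. k (r a) x - k (r b) x) \<le> \<epsilon> * (en (k (r a)) + en (k (r b)))
          + C * ((en (k (r a)) + en (k (r b))) / 2 - en (\<lambda>x. (k (r a) x + k (r b) x) / 2))"
        by (intro C kD)
      also have "\<dots> \<le> \<epsilon> * (2 * (m + 1)) + C * d"
      proof (intro add_mono mult_left_mono)
        show "en (k (r a)) + en (k (r b)) \<le> 2 * (m + 1)"
          using add_mono[OF less_imp_le[OF ab(1)] less_imp_le[OF ab(2)]] by simp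
        show "(en (k (r a)) + en (k (r b))) / 2 - en (\<lambda>x. (k (r a) x + k (r b) x) / 2) \<le> d"
          using ab midpoint[of "r a" "r b"] by (simp add: field_simps)
      qed (use \<epsilon> C(1) in auto)
      also have "\<epsilon> * (2 * (m + 1)) = e / 2" using \<open>m \<ge> 0\<close> by (simp add: \<epsilon>_def field_simps)
      also have "C * d < e / 2" using C(1) e by (simp add: d_def field_simps)
      finally show "en (\<lambda>x. k (r a) x - k (r b) x) < e" by simp
    qed
  qed
  obtain h where hD: "h \<in> D" and h_lim: "\<And>x. (\<lambda>n. k (r n) x) \<longlonglongrightarrow> h x"
    and h_en: "(\<lambda>n. en (\<lambda>x. k (r n) x - h x)) \<longlonglongrightarrow> 0"
    using D_complete[of "\<lambda>n. k (r n)", OF kD cauchy] r(2) by (auto simp: Cauchy_convergent_iff)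
  have h_le: "\<bar>h x\<bar> \<le> M" for x
    using LIMSEQ_le_const2[OF tendsto_rabs[OF h_lim[of x]]] k_le by blast
  have "p_harmonic E p h"
    unfolding p_harmonic_def
  proof
    fix z :: 'v
    define \<delta> where "\<delta> t x = (if x = z then t else 0)" for t :: real and x
    have \<delta>_fs: "\<delta> t \<in> finsupp_funs" for t
      unfolding finsupp_funs_def by (auto simp: \<delta>_def intro: finite_subset[of _ "{z}"])
    define lap where "lap t = p_laplacian E p (\<lambda>x. h x + \<delta> t x) z" for t
    \<comment> \<open>The perturbation \<open>w n\<close> of the minimizing sequence at the vertex \<open>z\<close> still has energy at least
      \<open>m\<close>, whereas the tangent inequality at \<open>w n\<close> bounds its energy by that of \<open>k (r n)\<close> minus
      \<open>2 p t\<close> times its Laplacian at \<open>z\<close>.  Placing the tangent at \<open>w n\<close> avoids differentiating the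
      energy.\<close>
    have sign: "t * lap t \<le> 0" for t
    proof -
      define w where "w n x = k (r n) x + \<delta> t x" for n x
      have "m + 2 * p * (t * p_laplacian E p (w n) z) \<le> en (k (r n))" for n
      proof -
        have wD: "w n \<in> D" unfolding w_def[abs_def] by (intro D_add kD finsupp_in_D \<delta>_fs)
        have dsum: "(\<Sum>x | \<delta> (- t) x \<noteq> 0. \<delta> (- t) x * p_laplacian E p (w n) x)
            = - t * p_laplacian E p (w n) z"
        proof (cases "t = 0")
          case False
          then have "{x. \<delta> (- t) x \<noteq> 0} = {z}" by (auto simp: \<delta>_def)
          then show ?thesis by (simp add: \<delta>_def)
        qed (simp add: \<delta>_def)
        have undo: "(\<lambda>x. w n x + \<delta> (- t) x) = k (r n)" by (auto simp: w_def \<delta>_def)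
        have "(\<lambda>x. (f x - k (r n) x) + \<delta> (- t) x) \<in> finsupp_funs"
          by (intro finsupp_funs_add k_fs \<delta>_fs)
        then have "(\<lambda>x. f x - w n x) \<in> finsupp_funs"
          by (rule finsupp_funs_subset) (auto simp: w_def \<delta>_def split: if_splits)
        from m_le[OF this] energy_above_tangent[OF wD \<delta>_fs, of "- t"] show ?thesis
          unfolding dsum undo by simp
      qed
      moreover have "(\<lambda>n. m + 2 * p * (t * p_laplacian E p (w n) z)) \<longlonglongrightarrow> m + 2 * p * (t * lap t)"
        unfolding lap_def w_def[abs_def] by (intro tendsto_intros tendsto_p_laplacian h_lim)
      ultimately have "m + 2 * p * (t * lap t) \<le> m"
        using LIMSEQ_le[OF _ LIMSEQ_subseq_LIMSEQ[OF k_lim r(1)]] by (fastforce simp: o_def)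
      then show ?thesis using p_gt_1 by (simp add: mult_le_0_iff)
    qed
    have "(lap \<longlongrightarrow> p_laplacian E p h z) (at 0)"
      unfolding lap_def[abs_def]
    proof (rule tendsto_p_laplacian)
      fix x
      have "((\<lambda>t. \<delta> t x) \<longlongrightarrow> 0) (at 0)"
        by (cases "x = z") (auto simp: \<delta>_def)
      from tendsto_add[OF tendsto_const[of "h x"] this]
      show "((\<lambda>t. h x + \<delta> t x) \<longlongrightarrow> h x) (at 0)" by simp
    qed
    then have lr: "(lap \<longlongrightarrow> p_laplacian E p h z) (at_left 0)" "(lap \<longlongrightarrow> p_laplacian E p h z) (at_right 0)"
      by (auto simp: filterlim_at_split)
    have "p_laplacian E p h z \<ge> 0"
    proof (rule tendsto_lowerbound[OF lr(1)])
      have "lap t \<ge> 0" if "t < 0" for t using sign[of t] that by (simp add: mult_le_0_iff)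
      then show "\<forall>\<^sub>F t in at_left 0. 0 \<le> lap t"
        unfolding eventually_at_filter by (intro always_eventually) simp
    qed simp
    moreover have "p_laplacian E p h z \<le> 0"
    proof (rule tendsto_upperbound[OF lr(2)])
      have "lap t \<le> 0" if "t > 0" for t using sign[of t] that by (simp add: mult_le_0_iff)
      then show "\<forall>\<^sub>F t in at_right 0. lap t \<le> 0"
        unfolding eventually_at_filter by (intro always_eventually) simp
    qed simp
    ultimately show "p_laplacian E p h z = 0" by simp
  qed
  moreover have "h \<in> BD" using hD h_le by (auto simp: BD_iff)
  moreover have "(\<lambda>x. f x - h x) \<in> bdd_finsupp_closure E p v0"
  proof -
    have "(\<lambda>n. en (\<lambda>x. k (r n) x - h x) + \<bar>k (r n) v0 - h v0\<bar> powr p) \<longlonglongrightarrow> 0 + \<bar>h v0 - h v0\<bar> powr p"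
      using p_gt_1 by (intro tendsto_add h_en tendsto_powr' tendsto_intros h_lim) auto
    from tendsto_powr'[OF this tendsto_const, of "1 / p"]
    have "(\<lambda>n. Dp_norm E p v0 (\<lambda>x. k (r n) x - h x)) \<longlonglongrightarrow> 0"
      using p_gt_1 by (simp add: Dp_norm_def)
    then have "\<exists>g\<in>finsupp_funs. Dp_norm E p v0 (\<lambda>x. f x - h x - g x) < e" if "e > 0" for e
      using order_tendstoD(2)[OF _ that] k_fs
      by (fastforce simp: eventually_sequentially intro: bexI[of _ "\<lambda>x. f x - k _ x"])
    moreover have "(\<lambda>x. f x - h x) \<in> BD" by (intro BD_diff f \<open>h \<in> BD\<close>)
    ultimately show ?thesis
      by (auto simp: bdd_finsupp_closure_def finsupp_closure_def BDp_def)
  qed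
  ultimately show ?thesis using that by blast
qed

section \<open>Characters\<close>

lemma char_add: "\<tau> \<in> Sp E p \<Longrightarrow> f \<in> BD \<Longrightarrow> g \<in> BD \<Longrightarrow> \<tau> (\<lambda>x. f x + g x) = \<tau> f + \<tau> g"
  and char_cmult: "\<tau> \<in> Sp E p \<Longrightarrow> f \<in> BD \<Longrightarrow> \<tau> (\<lambda>x. c * f x) = of_real c * \<tau> f"
  and char_mult: "\<tau> \<in> Sp E p \<Longrightarrow> f \<in> BD \<Longrightarrow> g \<in> BD \<Longrightarrow> \<tau> (\<lambda>x. f x * g x) = \<tau> f * \<tau> g"
  by (auto simp: Sp_def)

lemma char_const:
  assumes \<tau>: "\<tau> \<in> Sp E p"
  shows "\<tau> (\<lambda>_. c) = of_real c"
proof -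
  obtain f where f: "f \<in> BD" "\<tau> f \<noteq> 0" using \<tau> by (auto simp: Sp_def)
  have "\<tau> f = \<tau> f * \<tau> (\<lambda>_. 1)" using char_mult[OF \<tau> f(1) BD_const, of 1] by simp
  with f have "\<tau> (\<lambda>_. 1) = 1" by simp
  with char_cmult[OF \<tau> BD_const, of c 1] show ?thesis by simp
qed

lemma char_diff:
  assumes "\<tau> \<in> Sp E p" "f \<in> BD" "g \<in> BD"
  shows "\<tau> (\<lambda>x. f x - g x) = \<tau> f - \<tau> g"
  using char_add[OF assms(1,2) BD_cmult[OF assms(3), of "-1"]] char_cmult[OF assms(1,3), of "-1"]
  by simp

lemma BD_inverse_max: "f \<in> BD \<Longrightarrow> c > 0 \<Longrightarrow> (\<lambda>x. 1 / max (f x) c) \<in> BD"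
  by (rule BD_lipschitz[where \<psi> = "\<lambda>t. 1 / max t c", OF _ inverse_max_lipschitz]) auto

lemma char_nonzero:
  assumes \<tau>: "\<tau> \<in> Sp E p" and g: "g \<in> BD" and c: "c > 0" "\<And>x. c \<le> g x"
  shows "\<tau> g \<noteq> 0"
proof
  assume "\<tau> g = 0"
  then have "\<tau> (\<lambda>x. g x * (1 / max (g x) c)) = 0"
    using char_mult[OF \<tau> g BD_inverse_max[OF g c(1)]] by simp
  moreover have "(\<lambda>x. g x * (1 / max (g x) c)) = (\<lambda>_. 1)"
  proof
    fix x
    show "g x * (1 / max (g x) c) = 1" using c(1) c(2)[of x] by (simp add: max_absorb1)
  qed
  ultimately show False using char_const[OF \<tau>, of 1] by (simp only:) simp
qed

text \<open>
  Otherwise the real function \<open>|f - \<tau>(f)|^2\<close>, which lies in the algebra, is bounded away from zero and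
  thus has a reciprocal in the algebra, although \<open>\<tau>\<close> maps it to zero.  It follows that
  characters are real and bounded by the supremum.
\<close>
lemma char_approx:
  assumes \<tau>: "\<tau> \<in> Sp E p" and f: "f \<in> BD" and e: "e > 0"
  shows "\<exists>x. cmod (of_real (f x) - \<tau> f) < e"
proof (rule ccontr)
  assume "\<not> ?thesis"
  then have far: "e \<le> cmod (of_real (f x) - \<tau> f)" for x by (simp add: not_less)
  define a b where "a = Re (\<tau> f)" and "b = Im (\<tau> f)"
  define q where "q x = (f x - a) * (f x - a) + b * b" for x
  have fa: "(\<lambda>x. f x - a) \<in> BD" by (intro BD_diff f BD_const)
  have q: "q \<in> BD" unfolding q_def[abs_def] by (intro BD_add BD_mult fa BD_const)
  have "q x = (cmod (of_real (f x) - \<tau> f))\<^sup>2" for x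
    unfolding cmod_power2 by (simp add: q_def a_def b_def power2_eq_square)
  then have "e\<^sup>2 \<le> q x" for x using far[of x] e by (simp add: power_mono)
  then have "\<tau> q \<noteq> 0" using e by (intro char_nonzero[OF \<tau> q, of "e\<^sup>2"]) auto
  moreover have "\<tau> q = (\<tau> f - of_real a) * (\<tau> f - of_real a) + of_real (b * b)"
    unfolding q_def[abs_def]
    by (simp add: char_add[OF \<tau> BD_mult[OF fa fa] BD_const] char_mult[OF \<tau> fa fa]
        char_diff[OF \<tau> f BD_const] char_const[OF \<tau>] del: of_real_mult)
  moreover have "\<tau> f - of_real a = \<i> * of_real b" by (simp add: a_def b_def complex_eq_iff)
  ultimately show False by (simp add: complex_eq_iff)
qed

lemma char_real:
  assumes "\<tau> \<in> Sp E p" "f \<in> BD"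
  shows "\<tau> f = of_real (Re (\<tau> f))"
proof -
  have "\<bar>Im (\<tau> f)\<bar> \<le> 0 + e" if e: "e > 0" for e
  proof -
    obtain x where "cmod (of_real (f x) - \<tau> f) < e" using char_approx[OF assms e] by blast
    with abs_Im_le_cmod[of "of_real (f x) - \<tau> f"] show ?thesis by simp
  qed
  then have "\<bar>Im (\<tau> f)\<bar> \<le> 0" by (rule field_le_epsilon)
  then show ?thesis by (simp add: complex_eq_iff)
qed

lemma char_bound:
  assumes "\<tau> \<in> Sp E p" "f \<in> BD" "\<And>x. \<bar>f x\<bar> \<le> M"
  shows "cmod (\<tau> f) \<le> M"
proof (rule field_le_epsilon)
  fix e :: real assume "e > 0"
  then obtain x where "cmod (of_real (f x) - \<tau> f) < e" using char_approx[OF assms(1,2)] by blast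
  with norm_triangle_sub[of "\<tau> f" "of_real (f x)"] assms(3)[of x] show "cmod (\<tau> f) \<le> M + e"
    by (simp add: norm_minus_commute)
qed

lemma point_eval_apply: "f \<in> BD \<Longrightarrow> point_eval E p x f = of_real (f x)"
  by (simp add: point_eval_def)

lemma point_eval_in_Sp: "point_eval E p x \<in> Sp E p"
proof -
  have "point_eval E p x (\<lambda>_. 1) = 1" by (simp add: point_eval_apply[OF BD_const])
  then show ?thesis
    using BD_const[of 1]
    by (auto simp: Sp_def point_eval_apply BD_add BD_cmult BD_mult)
       (auto simp: point_eval_def intro!: bexI[of _ "\<lambda>_. 1"])
qed

lemma finsupp_in_closure: "g \<in> finsupp_funs \<Longrightarrow> g \<in> bdd_finsupp_closure E p v0"
proof -
  assume g: "g \<in> finsupp_funs"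
  have "range g \<subseteq> insert 0 (g ` {x. g x \<noteq> 0})" by auto
  then have "finite (range g)" using g by (auto simp: finsupp_funs_def intro: finite_subset)
  moreover have "Dp_norm E p v0 (\<lambda>x. g x - g x) = 0"
    by (simp add: Dp_norm_def energy_def local_energy_def)
  ultimately show ?thesis
    using g finsupp_in_D[OF g]
    by (auto simp: bdd_finsupp_closure_def finsupp_closure_def finite_imp_bounded intro!: bexI[OF _ g])
qed

lemma closure_subset_BD: "bdd_finsupp_closure E p v0 \<subseteq> BD"
  by (auto simp: bdd_finsupp_closure_def finsupp_closure_def BDp_def)

text \<open>
  The harmonic boundary is the hull of the ideal of bounded functions in the closure of the finitely
  supported ones.  Points of the graph do not belong to this hull because of their indicator functions.
\<close>
lemma harmonic_boundary_eq:
  "harmonic_boundary E p v0 = {\<tau> \<in> Sp E p. \<forall>f\<in>bdd_finsupp_closure E p v0. \<tau> f = 0}"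
proof -
  have "\<exists>f\<in>bdd_finsupp_closure E p v0. point_eval E p x f \<noteq> 0" for x
  proof -
    define \<delta> :: "'v \<Rightarrow> real" where "\<delta> y = (if y = x then 1 else 0)" for y
    have "\<delta> \<in> finsupp_funs"
      unfolding finsupp_funs_def by (auto simp: \<delta>_def intro: finite_subset[of _ "{x}"])
    then have cl: "\<delta> \<in> bdd_finsupp_closure E p v0" by (rule finsupp_in_closure)
    then have "\<delta> \<in> BD" using closure_subset_BD by blast
    then have "point_eval E p x \<delta> \<noteq> 0" by (simp add: point_eval_apply) (simp add: \<delta>_def)
    with cl show ?thesis by blast
  qed
  then show ?thesis
    by (auto simp: harmonic_boundary_def royden_boundary_def)
qed

lemma continuous_on_eval [continuous_intros]: "continuous_on S (\<lambda>\<tau>. \<tau> f :: complex)"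
  by (rule continuous_on_subset[OF continuous_on_product_coordinates]) simp

text \<open>
  A character is determined by closed conditions on finitely many coordinates at a time, inside a
  product of discs; the value at the constant 1 expresses that it is nonzero.  Coordinates outside the
  algebra are pinned to \<open>undefined\<close>, so that the product over all functions is still compact.
\<close>
lemma compact_Sp: "compact (Sp E p)"
proof -
  have "\<forall>f. \<exists>B. f \<in> BD \<longrightarrow> (\<forall>x. \<bar>f x\<bar> \<le> B)" by (auto simp: BD_iff)
  then obtain B where B: "\<And>f x. f \<in> BD \<Longrightarrow> \<bar>f x\<bar> \<le> B f" by metis
  define R where "R f = (if f \<in> BD then cball (0::complex) (B f) else {undefined})" for f
  have "compactin (product_topology (\<lambda>_. euclidean) UNIV) (PiE UNIV R)"
    unfolding compactin_PiE by (auto simp: R_def)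
  then have "compact (PiE UNIV R)"
    unfolding euclidean_product_topology by simp
  moreover define C where "C = (\<Inter>f\<in>BD. \<Inter>g\<in>BD. {\<tau>. \<tau> (\<lambda>x. f x + g x) = \<tau> f + \<tau> g})
      \<inter> (\<Inter>c. \<Inter>f\<in>BD. {\<tau>. \<tau> (\<lambda>x. c * f x) = of_real c * \<tau> f})
      \<inter> (\<Inter>f\<in>BD. \<Inter>g\<in>BD. {\<tau>. \<tau> (\<lambda>x. f x * g x) = \<tau> f * \<tau> g})
      \<inter> {\<tau> :: ('v \<Rightarrow> real) \<Rightarrow> complex. \<tau> (\<lambda>_. 1) = 1}"
  have "closed C"
    unfolding C_def by (intro closed_Int closed_INT ballI closed_Collect_eq continuous_intros)
  ultimately have "compact (PiE UNIV R \<inter> C)" by (rule compact_Int_closed)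
  moreover have "PiE UNIV R \<inter> C = Sp E p"
  proof (intro equalityI subsetI)
    fix \<tau> assume \<tau>: "\<tau> \<in> PiE UNIV R \<inter> C"
    then have "\<tau> f = undefined" if "f \<notin> BD" for f
      using that by (auto simp: PiE_iff R_def dest!: spec[of _ f])
    moreover have "\<exists>f\<in>BD. \<tau> f \<noteq> 0"
      using \<tau> BD_const[of 1] by (intro bexI[of _ "\<lambda>_. 1"]) (auto simp: C_def)
    ultimately show "\<tau> \<in> Sp E p"
      using \<tau> by (simp add: Sp_def C_def extensional_def)
  next
    fix \<tau> assume \<tau>: "\<tau> \<in> Sp E p"
    then have "\<tau> f \<in> R f" for f
      using char_bound[OF \<tau> _ B, of f] by (auto simp: R_def Sp_def extensional_def)
    moreover have "\<tau> \<in> C"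
      unfolding C_def
      using char_add[OF \<tau>] char_cmult[OF \<tau>] char_mult[OF \<tau>] char_const[OF \<tau>, of 1] by simp
    ultimately show "\<tau> \<in> PiE UNIV R \<inter> C" by auto
  qed
  ultimately show ?thesis by simp
qed

lemma compact_harmonic_boundary: "compact (harmonic_boundary E p v0)"
proof -
  have "closed (\<Inter>f\<in>bdd_finsupp_closure E p v0. {\<tau> :: ('v \<Rightarrow> real) \<Rightarrow> complex. \<tau> f = 0})"
    by (intro closed_INT ballI closed_Collect_eq continuous_intros)
  moreover have "harmonic_boundary E p v0 =
      Sp E p \<inter> (\<Inter>f\<in>bdd_finsupp_closure E p v0. {\<tau>. \<tau> f = 0})"
    by (auto simp: harmonic_boundary_eq)
  ultimately show ?thesis by (simp add: compact_Int_closed compact_Sp)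
qed

section \<open>Comparison of harmonic functions through boundary values\<close>

text \<open>
  The characters with \<open>\<tau>(w) \<ge> c\<close> form a compact set \<open>K\<close> away from the harmonic boundary.  Each of
  them is nonzero on some member of the ideal, so finitely many members suffice for all of \<open>K\<close>,
  and the sum \<open>s\<close> of their squares is bounded below by some \<open>d > 0\<close> on \<open>K\<close>.  In particular \<open>s \<ge> d\<close> at
  every vertex where \<open>w \<ge> c\<close>, and the excess of \<open>w\<close> over \<open>c\<close> can be divided by \<open>s\<close> within the algebra.
\<close>
lemma excess_weak_null:
  assumes w: "w \<in> BD" and le: "\<And>\<tau>. \<tau> \<in> harmonic_boundary E p v0 \<Longrightarrow> Re (\<tau> w) \<le> b"
    and b: "b < c"
  shows "weak_null (\<lambda>x. max (w x - c) 0)"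
proof -
  define K where "K = Sp E p \<inter> {\<tau>. c \<le> Re (\<tau> w)}"
  have K: "compact K"
    unfolding K_def by (intro compact_Int_closed compact_Sp closed_Collect_le continuous_intros)
  let ?I = "bdd_finsupp_closure E p v0"
  have cover: "K \<subseteq> (\<Union>g\<in>?I. {\<tau>. \<tau> g \<noteq> 0})"
  proof
    fix \<tau> assume \<tau>: "\<tau> \<in> K"
    then have "\<tau> \<notin> harmonic_boundary E p v0" using le[of \<tau>] b by (auto simp: K_def)
    with \<tau> show "\<tau> \<in> (\<Union>g\<in>?I. {\<tau>. \<tau> g \<noteq> 0})" by (auto simp: K_def harmonic_boundary_eq)
  qed
  have opn: "open {\<tau> :: ('v \<Rightarrow> real) \<Rightarrow> complex. \<tau> g \<noteq> 0}" for g
    by (intro open_Collect_neq continuous_intros)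
  obtain G where G: "G \<subseteq> ?I" "finite G" "K \<subseteq> (\<Union>g\<in>G. {\<tau>. \<tau> g \<noteq> 0})"
    using compactE_image[OF K opn cover] .
  define s where "s x = (\<Sum>g\<in>G. g x * g x)" for x
  define S where "S \<tau> = (\<Sum>g\<in>G. Re (\<tau> g) * Re (\<tau> g))" for \<tau> :: "('v \<Rightarrow> real) \<Rightarrow> complex"
  have s: "s \<in> BD \<and> weak_null s"
    unfolding s_def[abs_def] using G(2,1)
  proof (induction rule: finite_induct)
    case (insert g F)
    then have g: "g \<in> BD" "g \<in> finsupp_closure E p v0"
      using closure_subset_BD by (auto simp: bdd_finsupp_closure_def)
    then obtain M where "\<And>x. \<bar>g x\<bar> \<le> M" by (auto simp: BD_iff)
    from weak_null_mult[OF weak_null_closure[OF g(2)] this g(1)]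
    have "weak_null (\<lambda>x. g x * g x)" .
    with insert g show ?case by (auto intro!: BD_add BD_mult weak_null_add)
  qed (auto simp: BD_const weak_null_zero)
  obtain d where d: "d > 0" "\<And>\<tau>. \<tau> \<in> K \<Longrightarrow> d \<le> S \<tau>"
  proof (cases "K = {}")
    case False
    have "continuous_on K S" unfolding S_def[abs_def] by (intro continuous_intros)
    then obtain \<sigma> where \<sigma>: "\<sigma> \<in> K" "\<And>\<tau>. \<tau> \<in> K \<Longrightarrow> S \<sigma> \<le> S \<tau>"
      using continuous_attains_inf[OF K False] by blast
    obtain g where g: "g \<in> G" "\<sigma> g \<noteq> 0" using \<sigma>(1) G(3) by auto
    have "g \<in> BD" using g(1) G(1) closure_subset_BD by blast
    then have "Re (\<sigma> g) \<noteq> 0"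
      using char_real[of \<sigma> g] g(2) \<sigma>(1) by (auto simp: K_def)
    then have "Re (\<sigma> g) * Re (\<sigma> g) > 0" by (metis not_real_square_gt_zero)
    also have "Re (\<sigma> g) * Re (\<sigma> g) \<le> S \<sigma>"
      unfolding S_def by (intro member_le_sum g G) auto
    finally show ?thesis using \<sigma>(2) that by blast
  qed (use that[of 1] in auto)
  define k where "k x = max (w x - c) 0 * (1 / max (s x) d)" for x
  have k: "k \<in> BD"
    unfolding k_def[abs_def] using s d(1)
    by (intro BD_mult BD_inverse_max BD_lipschitz[OF w, of "\<lambda>t. max (t - c) 0" 1]) auto
  obtain M where "\<And>x. \<bar>s x\<bar> \<le> M" using s by (auto simp: BD_iff)
  then have "weak_null (\<lambda>x. s x * k x)" using s k by (intro weak_null_mult[of s M k]) auto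
  also have "(\<lambda>x. s x * k x) = (\<lambda>x. max (w x - c) 0)"
  proof
    fix x
    show "s x * k x = max (w x - c) 0"
    proof (cases "c \<le> w x")
      case True
      then have "point_eval E p x \<in> K"
        using point_eval_in_Sp by (simp add: K_def point_eval_apply[OF w])
      moreover have "S (point_eval E p x) = s x"
        unfolding S_def s_def using G(1) closure_subset_BD
        by (intro sum.cong) (auto simp: point_eval_apply subset_iff)
      ultimately have "d \<le> s x" using d(2) by fastforce
      then show ?thesis using d(1) by (simp add: k_def)
    qed (simp add: k_def)
  qed
  finally show ?thesis .
qed

text \<open>
  The excess of \<open>h1 - h2\<close> over \<open>b + e\<close> is constant.  A positive constant would make \<open>h1 - h2\<close> itself a
  constant larger than \<open>b\<close>, which is impossible at a point of the boundary.  If the boundary is empty,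
  constants are not controlled at all, and the statement fails.
\<close>
lemma harmonic_comparison:
  assumes ne: "harmonic_boundary E p v0 \<noteq> {}"
    and h: "h1 \<in> BD" "p_harmonic E p h1" "h2 \<in> BD" "p_harmonic E p h2"
    and le: "\<And>\<tau>. \<tau> \<in> harmonic_boundary E p v0 \<Longrightarrow> Re (\<tau> h1) \<le> Re (\<tau> h2) + b"
  shows "h1 x \<le> h2 x + b"
proof (rule field_le_epsilon)
  fix e :: real assume e: "e > 0"
  obtain \<tau> where \<tau>: "\<tau> \<in> harmonic_boundary E p v0" using ne by blast
  then have \<tau>S: "\<tau> \<in> Sp E p" by (simp add: harmonic_boundary_eq)
  define w where "w x = h1 x - h2 x" for x
  have w: "w \<in> BD" unfolding w_def[abs_def] by (intro BD_diff h)
  have w_le: "Re (\<sigma> w) \<le> b" if "\<sigma> \<in> harmonic_boundary E p v0" for \<sigma>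
    using le[OF that] that char_diff[OF _ h(1,3), of \<sigma>]
    by (simp add: w_def[abs_def] harmonic_boundary_eq)
  have "weak_null (\<lambda>x. max (w x - (b + e)) 0)"
    by (rule excess_weak_null[OF w, of v0 b]) (use w_le e in auto)
  then have const: "max (w x - (b + e)) 0 = max (w y - (b + e)) 0" for x y
    using h excess_weak_null_const[of h1 h2 "b + e"] by (simp add: w_def BD_iff)
  show "h1 x \<le> h2 x + b + e"
  proof (rule ccontr)
    assume "\<not> ?thesis"
    then have "w x > b + e" by (simp add: w_def)
    then have "w y = w x" for y using const[of x y] by (auto simp: max_def split: if_splits)
    then have "w = (\<lambda>_. w x)" by blast
    then have "Re (\<tau> w) = w x" using char_const[OF \<tau>S, of "w x"] by simp
    with w_le[OF \<tau>] \<open>w x > b + e\<close> e show False by simp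
  qed
qed

section \<open>The Dirichlet problem on the harmonic boundary\<close>

text \<open>
  The restrictions of Gelfand transforms to the boundary form a function ring by the
  multiplicativity and reality of characters.  They separate points because distinct characters differ
  on the algebra.
\<close>
lemma boundary_density:
  assumes f: "continuous_on (harmonic_boundary E p v0) f" and e: "e > 0"
  shows "\<exists>g\<in>BD. \<forall>\<tau>\<in>harmonic_boundary E p v0. \<bar>f \<tau> - Re (\<tau> g)\<bar> < e"
proof -
  let ?H = "harmonic_boundary E p v0"
  have HS: "\<tau> \<in> Sp E p" if "\<tau> \<in> ?H" for \<tau> using that by (simp add: harmonic_boundary_eq)
  define R where "R = {\<phi>. continuous_on ?H \<phi> \<and> (\<exists>g\<in>BD. \<forall>\<tau>\<in>?H. \<phi> \<tau> = Re (\<tau> g))}"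
  interpret function_ring_on R ?H
  proof
    show "compact ?H" by (rule compact_harmonic_boundary)
    show "continuous_on ?H \<phi>" if "\<phi> \<in> R" for \<phi> using that by (simp add: R_def)
    show "(\<lambda>\<tau>. \<phi> \<tau> + \<psi> \<tau>) \<in> R" if R: "\<phi> \<in> R" "\<psi> \<in> R" for \<phi> \<psi>
    proof -
      obtain g k where "g \<in> BD" "k \<in> BD" "\<And>\<tau>. \<tau> \<in> ?H \<Longrightarrow> \<phi> \<tau> = Re (\<tau> g)"
        "\<And>\<tau>. \<tau> \<in> ?H \<Longrightarrow> \<psi> \<tau> = Re (\<tau> k)" using R by (auto simp: R_def)
      then show ?thesis
        using R by (auto simp: R_def char_add[OF HS] intro!: continuous_intros bexI[OF _ BD_add[of g k]])
    qed
    show "(\<lambda>\<tau>. \<phi> \<tau> * \<psi> \<tau>) \<in> R" if R: "\<phi> \<in> R" "\<psi> \<in> R" for \<phi> \<psi>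
    proof -
      obtain g k where gk: "g \<in> BD" "k \<in> BD" "\<And>\<tau>. \<tau> \<in> ?H \<Longrightarrow> \<phi> \<tau> = Re (\<tau> g)"
        "\<And>\<tau>. \<tau> \<in> ?H \<Longrightarrow> \<psi> \<tau> = Re (\<tau> k)" using R by (auto simp: R_def)
      have "Re (\<tau> (\<lambda>x. g x * k x)) = Re (\<tau> g) * Re (\<tau> k)" if "\<tau> \<in> ?H" for \<tau>
        using char_mult[OF HS[OF that] gk(1,2)] char_real[OF HS[OF that] gk(1)]
          char_real[OF HS[OF that] gk(2)] by (metis Re_complex_of_real of_real_mult)
      then show ?thesis
        using R gk by (auto simp: R_def intro!: continuous_intros bexI[OF _ BD_mult[of g k]])
    qed
    show "(\<lambda>_. c) \<in> R" for c
      by (auto simp: R_def char_const[OF HS] intro!: bexI[OF _ BD_const[of c]])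
    show "\<exists>\<phi>\<in>R. \<phi> \<sigma> \<noteq> \<phi> \<tau>" if st: "\<sigma> \<in> ?H" "\<tau> \<in> ?H" "\<sigma> \<noteq> \<tau>" for \<sigma> \<tau>
    proof -
      have ext: "\<sigma> \<in> extensional BD" "\<tau> \<in> extensional BD"
        using HS[OF st(1)] HS[OF st(2)] by (auto simp: Sp_def)
      obtain g where g: "g \<in> BD" "\<sigma> g \<noteq> \<tau> g"
        using extensionalityI[OF ext] st(3) by blast
      have mem: "(\<lambda>\<tau>. Re (\<tau> g)) \<in> R"
        unfolding R_def mem_Collect_eq
        by (intro conjI bexI[OF _ g(1)] ballI refl continuous_on_Re continuous_on_eval)
      have "Re (\<sigma> g) \<noteq> Re (\<tau> g)"
        using g(2) char_real[OF HS[OF st(1)] g(1)] char_real[OF HS[OF st(2)] g(1)] by auto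
      then show ?thesis by (rule bexI[OF _ mem])
    qed
  qed
  show ?thesis
    using Stone_Weierstrass_basic[OF f e] by (fastforce simp: R_def)
qed

text \<open>
  The Gelfand topology is given as a product over the algebra only, whereas compactness and the
  Stone-Weierstrass theorem are applied in the product over all functions.  The inclusion between
  the two is continuous, as all further coordinates are constant.
\<close>
lemma continuous_on_harmonic_boundary:
  assumes "continuous_map (subtopology (Sp_topology E p) (harmonic_boundary E p v0)) euclideanreal f"
  shows "continuous_on (harmonic_boundary E p v0) f"
proof -
  let ?H = "harmonic_boundary E p v0"
  have sub: "?H \<subseteq> Sp E p" by (auto simp: harmonic_boundary_eq)
  have "continuous_map (top_of_set ?H) (product_topology (\<lambda>_. euclidean) BD) (\<lambda>\<tau>. \<tau>)"
    unfolding continuous_map_componentwise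
    using sub by (auto simp: Sp_def intro!: continuous_intros)
  then have "continuous_map (top_of_set ?H) (subtopology (Sp_topology E p) ?H) (\<lambda>\<tau>. \<tau>)"
    using sub by (auto simp: Sp_topology_def continuous_map_in_subtopology)
  from continuous_map_compose[OF this assms] show ?thesis by (simp add: o_def)
qed

lemma limitin_Sp_eval:
  assumes "limitin (Sp_topology E p) (\<lambda>n. point_eval E p (x n)) \<tau> sequentially" and f: "f \<in> BD"
  shows "(\<lambda>n. f (x n)) \<longlonglongrightarrow> Re (\<tau> f)"
proof -
  have "continuous_map (Sp_topology E p) euclidean (\<lambda>\<tau>. \<tau> f)"
    unfolding Sp_topology_def using f
    by (intro continuous_map_from_subtopology continuous_map_product_projection)
  from continuous_map_limit[OF this assms(1)]
  have "(\<lambda>n. point_eval E p (x n) f) \<longlonglongrightarrow> \<tau> f" by (simp add: o_def)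
  from tendsto_Re[OF this] show ?thesis by (simp add: point_eval_apply[OF f])
qed

lemma p_harmonic_limit:
  assumes "\<And>n. p_harmonic E p (u n)" "\<And>x. (\<lambda>n. u n x) \<longlonglongrightarrow> v x"
  shows "p_harmonic E p v"
  unfolding p_harmonic_def
proof
  fix x
  have "(\<lambda>n. p_laplacian E p (u n) x) \<longlonglongrightarrow> p_laplacian E p v x"
    by (intro tendsto_p_laplacian assms(2))
  then show "p_laplacian E p v x = 0"
    using assms(1) by (simp add: p_harmonic_def LIMSEQ_const_iff)
qed

text \<open>
  Passing from \<open>g\<close> to its harmonic part changes it by a member of the ideal, on which all characters of
  the harmonic boundary vanish.
\<close>
lemma dirichlet_problem_approx:
  assumes f: "continuous_on (harmonic_boundary E p v0) f" and e: "e > 0"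
  shows "\<exists>h\<in>BD. p_harmonic E p h \<and> (\<forall>\<tau>\<in>harmonic_boundary E p v0. \<bar>f \<tau> - Re (\<tau> h)\<bar> < e)"
proof -
  obtain g where g: "g \<in> BD" "\<And>\<tau>. \<tau> \<in> harmonic_boundary E p v0 \<Longrightarrow> \<bar>f \<tau> - Re (\<tau> g)\<bar> < e"
    using boundary_density[OF f e] by blast
  obtain h where h: "h \<in> BD" "p_harmonic E p h" "(\<lambda>x. g x - h x) \<in> bdd_finsupp_closure E p v0"
    using harmonic_part[OF g(1)] .
  have "\<bar>f \<tau> - Re (\<tau> h)\<bar> < e" if "\<tau> \<in> harmonic_boundary E p v0" for \<tau>
    using that g(2)[OF that] h(3) char_diff[OF _ g(1) h(1), of \<tau>]
    by (simp add: harmonic_boundary_eq)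
  with h(1,2) show ?thesis by blast
qed

text \<open>
  The solution need not have finite energy, and then it has no Gelfand transform.  Its boundary values are
  therefore expressed through approximation by elements of \<open>BDp E p\<close>, uniformly on the graph and on
  the boundary.
\<close>
lemma dirichlet_problem:
  assumes f: "continuous_on (harmonic_boundary E p v0) f"
  obtains h where "p_harmonic E p h"
    "\<And>e. e > 0 \<Longrightarrow> \<exists>u\<in>BD. (\<forall>x. \<bar>h x - u x\<bar> \<le> e) \<and>
       (\<forall>\<tau>\<in>harmonic_boundary E p v0. \<bar>f \<tau> - Re (\<tau> u)\<bar> \<le> e)"
proof (cases "harmonic_boundary E p v0 = {}")
  case True
  have "p_harmonic E p (\<lambda>_. 0)" by (simp add: p_harmonic_def p_laplacian_def)
  moreover have "\<exists>u\<in>BD. (\<forall>x. \<bar>0 - u x\<bar> \<le> e) \<and>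
       (\<forall>\<tau>\<in>harmonic_boundary E p v0. \<bar>f \<tau> - Re (\<tau> u)\<bar> \<le> e)" if "e > 0" for e
    using that True by (intro bexI[of _ "\<lambda>_. 0"] BD_const) auto
  ultimately show ?thesis by (rule that)
next
  case False
  define \<epsilon> where "\<epsilon> n = inverse (real (Suc n))" for n
  have \<epsilon>: "\<epsilon> n > 0" for n by (simp add: \<epsilon>_def)
  have \<epsilon>_lim: "\<epsilon> \<longlonglongrightarrow> 0" unfolding \<epsilon>_def[abs_def] by (rule LIMSEQ_inverse_real_of_nat)
  have "\<forall>n. \<exists>h\<in>BD. p_harmonic E p h \<and> (\<forall>\<tau>\<in>harmonic_boundary E p v0. \<bar>f \<tau> - Re (\<tau> h)\<bar> < \<epsilon> n)"
    using dirichlet_problem_approx[OF f \<epsilon>] by blast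
  then obtain u where u: "\<And>n. u n \<in> BD" "\<And>n. p_harmonic E p (u n)"
      "\<And>n \<tau>. \<tau> \<in> harmonic_boundary E p v0 \<Longrightarrow> \<bar>f \<tau> - Re (\<tau> (u n))\<bar> < \<epsilon> n" by metis
  have one: "u m x \<le> u n x + (\<epsilon> m + \<epsilon> n)" for m n x
  proof (rule harmonic_comparison[OF False u(1,2) u(1,2)])
    fix \<tau> assume "\<tau> \<in> harmonic_boundary E p v0"
    from u(3)[OF this, of m] u(3)[OF this, of n]
    show "Re (\<tau> (u m)) \<le> Re (\<tau> (u n)) + (\<epsilon> m + \<epsilon> n)" by linarith
  qed
  have close: "\<bar>u m x - u n x\<bar> \<le> \<epsilon> m + \<epsilon> n" for m n x
    using one[of m x n] one[of n x m] by linarith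
  have "Cauchy (\<lambda>n. u n x)" for x
  proof (rule CauchyI)
    fix e :: real assume "e > 0"
    then obtain n0 where n0: "\<And>n. n \<ge> n0 \<Longrightarrow> \<epsilon> n < e / 2"
      using order_tendstoD(2)[OF \<epsilon>_lim, of "e / 2"] by (auto simp: eventually_sequentially)
    show "\<exists>M. \<forall>m\<ge>M. \<forall>n\<ge>M. norm (u m x - u n x) < e"
    proof (intro exI[of _ n0] allI impI)
      fix m n assume "n0 \<le> m" "n0 \<le> n"
      with close[of m x n] n0[of m] n0[of n] show "norm (u m x - u n x) < e" by simp
    qed
  qed
  then obtain h where h: "\<And>x. (\<lambda>n. u n x) \<longlonglongrightarrow> h x"
    unfolding Cauchy_convergent_iff convergent_def by metis
  have near: "\<bar>h x - u n x\<bar> \<le> \<epsilon> n" for n x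
  proof (rule LIMSEQ_le)
    show "(\<lambda>m. \<bar>u m x - u n x\<bar>) \<longlonglongrightarrow> \<bar>h x - u n x\<bar>" by (intro tendsto_intros h)
    show "(\<lambda>m. \<epsilon> m + \<epsilon> n) \<longlonglongrightarrow> \<epsilon> n" using tendsto_add[OF \<epsilon>_lim tendsto_const[of "\<epsilon> n"]] by simp
  qed (use close in blast)
  show ?thesis
  proof (rule that)
    show "p_harmonic E p h" by (rule p_harmonic_limit[OF u(2) h])
    fix e :: real assume "e > 0"
    then obtain n where n: "\<epsilon> n < e"
      using order_tendstoD(2)[OF \<epsilon>_lim, of e] by (auto simp: eventually_sequentially)
    have "\<bar>h x - u n x\<bar> \<le> e" for x using near[of x n] n by linarith
    moreover have "\<bar>f \<tau> - Re (\<tau> (u n))\<bar> \<le> e" if "\<tau> \<in> harmonic_boundary E p v0" for \<tau>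
      using u(3)[OF that, of n] n by linarith
    ultimately show "\<exists>u\<in>BD. (\<forall>x. \<bar>h x - u x\<bar> \<le> e) \<and>
       (\<forall>\<tau>\<in>harmonic_boundary E p v0. \<bar>f \<tau> - Re (\<tau> u)\<bar> \<le> e)"
      by (intro bexI[OF _ u(1)[of n]]) simp
  qed
qed

end

theorem theorem2p6:
  fixes p :: real
    and E :: "'v \<Rightarrow> 'v \<Rightarrow> bool"
    and v0 :: 'v
    and f :: "(('v \<Rightarrow> real) \<Rightarrow> complex) \<Rightarrow> real"
  assumes "p > 1"
    and "countable (UNIV :: 'v set)"
    and "infinite (UNIV :: 'v set)"
    and "symp E"
    and "irreflp E"
    and "connected_graph E"
    and "bounded_degree E"
    and "continuous_map (subtopology (Sp_topology E p) (harmonic_boundary E p v0)) euclideanreal f"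
  shows "\<exists>h :: 'v \<Rightarrow> real. p_harmonic E p h \<and>
    (\<forall>\<tau>\<in>harmonic_boundary E p v0. \<forall>x :: nat \<Rightarrow> 'v.
       limitin (Sp_topology E p) (\<lambda>n. point_eval E p (x n)) \<tau> sequentially \<longrightarrow>
       (\<lambda>n. h (x n)) \<longlonglongrightarrow> f \<tau>)"
proof -
  interpret energy_graph E p
    by unfold_locales (use assms in auto)
  obtain h where harm: "p_harmonic E p h"
    and approx: "\<And>e. e > 0 \<Longrightarrow> \<exists>u\<in>BD. (\<forall>x. \<bar>h x - u x\<bar> \<le> e) \<and>
       (\<forall>\<tau>\<in>harmonic_boundary E p v0. \<bar>f \<tau> - Re (\<tau> u)\<bar> \<le> e)"
    using dirichlet_problem[OF continuous_on_harmonic_boundary[OF assms(8)]] by blast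
  have "(\<lambda>n. h (x n)) \<longlonglongrightarrow> f \<tau>"
    if \<tau>: "\<tau> \<in> harmonic_boundary E p v0"
      and lim: "limitin (Sp_topology E p) (\<lambda>n. point_eval E p (x n)) \<tau> sequentially" for \<tau> x
  proof (rule tendstoI)
    fix e :: real assume e: "e > 0"
    then obtain u where u: "u \<in> BD" "\<And>x. \<bar>h x - u x\<bar> \<le> e / 3" "\<bar>f \<tau> - Re (\<tau> u)\<bar> \<le> e / 3"
      using approx[of "e / 3"] \<tau> by auto
    have "\<forall>\<^sub>F n in sequentially. dist (u (x n)) (Re (\<tau> u)) < e / 3"
      by (rule tendstoD[OF limitin_Sp_eval[OF lim u(1)]]) (use e in simp)
    then show "\<forall>\<^sub>F n in sequentially. dist (h (x n)) (f \<tau>) < e"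
    proof eventually_elim
      case (elim n)
      with u(2)[of "x n"] u(3) show ?case by (simp add: dist_real_def abs_if split: if_splits)
    qed
  qed
  with harm show ?thesis by blast
qed

end
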